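(* There is an algorithm which, given an $n\times n$ Kalmanson matrix $C=(c_{ij})$ and a nonempty subset $S\subseteq\{1,2,\ldots,n\}$ such that $n+|S|$ is even, finds an optimal solution to the balanced 2-period travelling salesman problem (balanced 2TSP) with distance matrix $C$ and set $S$ of nodes to be visited in both periods, in $O(n^3)$ time.
   Context: A symmetric $n\times n$ real matrix $C=(c_{ij})$ is a Kalmanson matrix if for all $1\le i<j<\ell<m\le n$ it satisfies $$c_{ij}+c_{\ell m}\le c_{i\ell}+c_{jm}\qquad\text{and}\qquad c_{im}+c_{j\ell}\le c_{i\ell}+c_{jm}.$$ The balanced 2TSP is defined as follows. The input is an $n\times n$ distance matrix $C=(c_{ij})$ and a subset $S\subseteq\{1,\ldots,n\}$ of nodes (the fixed nodes, to be visited in both periods), where $n+|S|=2p$ is even. A tour on a set of $p$ nodes is a cyclic sequence $\langle \tau_1,\tau_2,\ldots,\tau_p,\tau_{p+1}=\tau_1\rangle$ visiting each node of the set exactly once and returning to its start; its length is $\sum_{i=1}^{p}c_{\tau_i,\tau_{i+1}}$. A feasible solution is a pair of tours such that every node of $S$ appears in each of the two tours, every node of $\{1,\ldots,n\}\setminus S$ appears in exactly one of the two tours, and each of the two tours contains exactly $p$ nodes (the balancing condition). An optimal solution is a feasible solution minimizing the sum of the lengths of the two tours. Running time is measured as the number of elementary steps, where an arithmetic operation on, or a comparison of, numbers counts as one step. The rows and columns of the input matrix are given in the numbering in which the Kalmanson inequalities hold. *)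

theory Defs
  imports Complex_Main "HOL-Library.Landau_Symbols"
begin

section \<open>Kalmanson matrices and the balanced 2TSP\<close>

text \<open>An \<open>n \<times> n\<close> matrix is a function \<open>nat \<Rightarrow> nat \<Rightarrow> real\<close> of which only the
  entries with both indices in \<open>{1..n}\<close> matter.\<close>

definition kalmanson :: "nat \<Rightarrow> (nat \<Rightarrow> nat \<Rightarrow> real) \<Rightarrow> bool" where
  "kalmanson n C \<longleftrightarrow>
     (\<forall>i\<in>{1..n}. \<forall>j\<in>{1..n}. C i j = C j i) \<and>
     (\<forall>i j l m. 1 \<le> i \<and> i < j \<and> j < l \<and> l < m \<and> m \<le> n \<longrightarrow>
        C i j + C l m \<le> C i l + C j m \<and>
        C i m + C j l \<le> C i l + C j m)"

text \<open>A tour is given by one of its linear listings \<open>[\<tau>\<^sub>1, \<dots>, \<tau>\<^sub>p]\<close>; the return to the start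
  is supplied by the index arithmetic modulo \<open>p\<close>. For \<open>p = 1\<close> the length is the diagonal
  entry, for \<open>p = 2\<close> the edge is traversed twice.\<close>

definition tour_on :: "nat set \<Rightarrow> nat list \<Rightarrow> bool" where
  "tour_on V \<tau> \<longleftrightarrow> distinct \<tau> \<and> set \<tau> = V"

definition tour_length :: "(nat \<Rightarrow> nat \<Rightarrow> real) \<Rightarrow> nat list \<Rightarrow> real" where
  "tour_length C \<tau> = (\<Sum>i<length \<tau>. C (\<tau> ! i) (\<tau> ! (Suc i mod length \<tau>)))"

definition feasible_2tsp :: "nat \<Rightarrow> nat set \<Rightarrow> nat list \<times> nat list \<Rightarrow> bool" where
  "feasible_2tsp n S = (\<lambda>(\<sigma>, \<tau>). \<exists>V W.
     tour_on V \<sigma> \<and> tour_on W \<tau> \<and> V \<subseteq> {1..n} \<and> W \<subseteq> {1..n} \<and>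
     (\<forall>v\<in>S. v \<in> V \<and> v \<in> W) \<and>
     (\<forall>v\<in>{1..n} - S. (v \<in> V) \<noteq> (v \<in> W)) \<and>
     2 * card V = n + card S \<and> 2 * card W = n + card S)"

definition total_length :: "(nat \<Rightarrow> nat \<Rightarrow> real) \<Rightarrow> nat list \<times> nat list \<Rightarrow> real" where
  "total_length C = (\<lambda>(\<sigma>, \<tau>). tour_length C \<sigma> + tour_length C \<tau>)"

definition optimal_2tsp ::
    "nat \<Rightarrow> (nat \<Rightarrow> nat \<Rightarrow> real) \<Rightarrow> nat set \<Rightarrow> nat list \<times> nat list \<Rightarrow> bool" where
  "optimal_2tsp n C S = is_arg_min (total_length C) (feasible_2tsp n S)"


section \<open>Algorithms and their running time\<close>

text \<open>Algorithms are programs of a while language for the real RAM. The memory consists of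
  named arrays of natural numbers (used as indices, counters, node names) and named arrays
  of reals. An array takes a list of indices; a scalar variable is an array accessed with the
  empty list. The number of indices in each access is fixed by the program text.

  Natural numbers only admit addition and (truncated) subtraction: multiplication at unit
  cost would be unreasonably powerful on unbounded integers. Reals admit the four field
  operations and comparison. The only real constants are integers, and there is no conversion
  between the two kinds of numbers, in particular no rounding.\<close>

datatype nexp =
    NConst nat
  | NGet string "nexp list"
  | NAdd nexp nexp
  | NSub nexp nexp

datatype rexp =
    RConst int
  | RGet string "nexp list"
  | RAdd rexp rexp
  | RSub rexp rexp
  | RMul rexp rexp
  | RDiv rexp rexp

datatype bexp =
    NLess nexp nexp
  | RLess rexp rexp
  | BNot bexp
  | BAnd bexp bexp

datatype com =
    Skip
  | NAssign string "nexp list" nexp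
  | RAssign string "nexp list" rexp
  | Seq com com
  | Cond bexp com com
  | While bexp com

record state =
  nmem :: "string \<Rightarrow> nat list \<Rightarrow> nat"
  rmem :: "string \<Rightarrow> nat list \<Rightarrow> real"

fun nval :: "nexp \<Rightarrow> state \<Rightarrow> nat" where
  "nval (NConst k) s = k"
| "nval (NGet a ix) s = nmem s a (map (\<lambda>e. nval e s) ix)"
| "nval (NAdd e f) s = nval e s + nval f s"
| "nval (NSub e f) s = nval e s - nval f s"

text \<open>Division by zero yields zero, as usual in HOL.\<close>

fun rval :: "rexp \<Rightarrow> state \<Rightarrow> real" where
  "rval (RConst k) s = of_int k"
| "rval (RGet a ix) s = rmem s a (map (\<lambda>e. nval e s) ix)"
| "rval (RAdd e f) s = rval e s + rval f s"
| "rval (RSub e f) s = rval e s - rval f s"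
| "rval (RMul e f) s = rval e s * rval f s"
| "rval (RDiv e f) s = rval e s / rval f s"

fun bval :: "bexp \<Rightarrow> state \<Rightarrow> bool" where
  "bval (NLess e f) s \<longleftrightarrow> nval e s < nval f s"
| "bval (RLess e f) s \<longleftrightarrow> rval e s < rval f s"
| "bval (BNot b) s \<longleftrightarrow> \<not> bval b s"
| "bval (BAnd b c) s \<longleftrightarrow> bval b s \<and> bval c s"

text \<open>Every constant, memory access, arithmetic operation, comparison and Boolean connective
  counts as one elementary step; so does every assignment, branch, loop test and \<open>Skip\<close>.\<close>

fun ncost :: "nexp \<Rightarrow> nat" where
  "ncost (NConst k) = 1"
| "ncost (NGet a ix) = 1 + sum_list (map ncost ix)"
| "ncost (NAdd e f) = 1 + ncost e + ncost f"
| "ncost (NSub e f) = 1 + ncost e + ncost f"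

fun rcost :: "rexp \<Rightarrow> nat" where
  "rcost (RConst k) = 1"
| "rcost (RGet a ix) = 1 + sum_list (map ncost ix)"
| "rcost (RAdd e f) = 1 + rcost e + rcost f"
| "rcost (RSub e f) = 1 + rcost e + rcost f"
| "rcost (RMul e f) = 1 + rcost e + rcost f"
| "rcost (RDiv e f) = 1 + rcost e + rcost f"

fun bcost :: "bexp \<Rightarrow> nat" where
  "bcost (NLess e f) = 1 + ncost e + ncost f"
| "bcost (RLess e f) = 1 + rcost e + rcost f"
| "bcost (BNot b) = 1 + bcost b"
| "bcost (BAnd b c) = 1 + bcost b + bcost c"

definition nwrite :: "string \<Rightarrow> nat list \<Rightarrow> nat \<Rightarrow> state \<Rightarrow> state" where
  "nwrite a ks x s = s\<lparr>nmem := (nmem s)(a := (nmem s a)(ks := x))\<rparr>"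

definition rwrite :: "string \<Rightarrow> nat list \<Rightarrow> real \<Rightarrow> state \<Rightarrow> state" where
  "rwrite a ks x s = s\<lparr>rmem := (rmem s)(a := (rmem s a)(ks := x))\<rparr>"

text \<open>\<open>exec c s t s'\<close>: started in \<open>s\<close>, the program \<open>c\<close> halts in \<open>s'\<close> after \<open>t\<close> steps.\<close>

inductive exec :: "com \<Rightarrow> state \<Rightarrow> nat \<Rightarrow> state \<Rightarrow> bool" where
  Skip: "exec Skip s 1 s"
| NAssign: "exec (NAssign a ix e) s (1 + sum_list (map ncost ix) + ncost e)
     (nwrite a (map (\<lambda>i. nval i s) ix) (nval e s) s)"
| RAssign: "exec (RAssign a ix e) s (1 + sum_list (map ncost ix) + rcost e)
     (rwrite a (map (\<lambda>i. nval i s) ix) (rval e s) s)"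
| Seq: "exec c s t s' \<Longrightarrow> exec d s' u s'' \<Longrightarrow> exec (Seq c d) s (t + u) s''"
| CondTrue: "bval b s \<Longrightarrow> exec c s t s' \<Longrightarrow> exec (Cond b c d) s (1 + bcost b + t) s'"
| CondFalse: "\<not> bval b s \<Longrightarrow> exec d s t s' \<Longrightarrow> exec (Cond b c d) s (1 + bcost b + t) s'"
| WhileFalse: "\<not> bval b s \<Longrightarrow> exec (While b c) s (1 + bcost b) s"
| WhileTrue: "bval b s \<Longrightarrow> exec c s t s' \<Longrightarrow> exec (While b c) s' u s'' \<Longrightarrow>
     exec (While b c) s (1 + bcost b + t + u) s''"

inductive_cases exec_elims:
  "exec Skip s t s'"
  "exec (NAssign a ix e) s t s'"
  "exec (RAssign a ix e) s t s'"
  "exec (Seq c d) s t s'"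
  "exec (Cond b c d) s t s'"
  "exec (While b c) s t s'"

lemma exec_deterministic: "exec c s t s' \<Longrightarrow> exec c s u s'' \<Longrightarrow> u = t \<and> s'' = s'"
proof (induction arbitrary: u s'' rule: exec.induct)
  case (Seq c s t s' d v r)
  from Seq.prems obtain t1 s1 u1
    where "u = t1 + u1" "exec c s t1 s1" "exec d s1 u1 s''"
    by (cases rule: exec.cases) blast
  with Seq.IH show ?case by blast
next
  case (CondTrue b s c t s' d)
  from CondTrue.prems CondTrue.hyps obtain t1
    where "u = 1 + bcost b + t1" "exec c s t1 s''"
    by (cases rule: exec.cases) blast+
  with CondTrue.IH show ?case by blast
next
  case (CondFalse b s d t s' c)
  from CondFalse.prems CondFalse.hyps obtain t1
    where "u = 1 + bcost b + t1" "exec d s t1 s''"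
    by (cases rule: exec.cases) blast+
  with CondFalse.IH show ?case by blast
next
  case (WhileFalse b s c)
  from WhileFalse.prems WhileFalse.hyps show ?case
    by (cases rule: exec.cases) blast+
next
  case (WhileTrue b s c t s' v r)
  from WhileTrue.prems WhileTrue.hyps obtain t1 s1 u1
    where "u = 1 + bcost b + t1 + u1" "exec c s t1 s1" "exec (While b c) s1 u1 s''"
    by (cases rule: exec.cases) blast+
  with WhileTrue.IH show ?case by blast
qed (erule exec_elims; simp)+

text \<open>Input: the scalar \<open>n\<close>, the array \<open>S\<close> holding the characteristic vector of the fixed
  nodes, and the array \<open>C\<close> holding the matrix. All other cells are initially zero.\<close>

definition input_2tsp :: "nat \<Rightarrow> (nat \<Rightarrow> nat \<Rightarrow> real) \<Rightarrow> nat set \<Rightarrow> state" where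
  "input_2tsp n C S = \<lparr>
     nmem = (\<lambda>a ks.
       if a = ''n'' \<and> ks = [] then n
       else if a = ''S'' \<and> (\<exists>i\<in>S. ks = [i]) then 1
       else 0),
     rmem = (\<lambda>a ks.
       if a = ''C'' \<and> (\<exists>i\<in>{1..n}. \<exists>j\<in>{1..n}. ks = [i, j]) then C (ks ! 0) (ks ! 1)
       else 0)\<rparr>"

text \<open>Output: cell \<open>0\<close> of an array \<open>a\<close> holds the number \<open>k\<close> of nodes of a tour, and cells
  \<open>1, \<dots>, k\<close> hold its nodes in the order of the tour.\<close>

definition read_tour :: "string \<Rightarrow> state \<Rightarrow> nat list" where
  "read_tour a s = map (\<lambda>k. nmem s a [k]) [1..<Suc (nmem s a [0])]"

definition output_2tsp :: "state \<Rightarrow> nat list \<times> nat list" where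
  "output_2tsp s = (read_tour ''T1'' s, read_tour ''T2'' s)"

end

theory Submission
  imports Defs "HOL-Library.Extended_Real"
begin

text \<open>In a Kalmanson matrix, the increasing order of the nodes is a shortest tour on every set of nodes
(\<open>kalmanson_sorted_tour_optimal\<close>). A solution of the balanced 2TSP is therefore determined by
the distribution of the non-fixed nodes over the two tours. Both tours pass through some fixed
node \<open>s\<^sub>0\<close>, and a cyclic shift does not change the length of a tour. So both tours
may start at \<open>s\<^sub>0\<close> and visit their nodes in the cyclic order that starts there.

Deal out the nodes in this cyclic order. All that the remaining decisions depend on is the last
node of the first tour, the last node of the second tour, and the number of nodes on the first
tour; how many nodes have been dealt out need not be recorded, because the node dealt out last ends
at least one of the tours. So there are \<open>O(n\<^sup>3)\<close> states. The least cost
\<open>completion\<close> of finishing both tours from a state is a minimum over at most two successor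
states, with value \<open>\<infinity>\<close> if balance can no longer be reached. It is a lower bound for
every feasible solution (\<open>togo_lower_bound\<close>), and following the minimizing decisions from
the initial state attains it (\<open>optimal_if_routed\<close>).

The program tabulates the values in decreasing order of the number of nodes dealt out, in constant
time for each state (\<open>reaches_fill\<close>), and then reads off the decisions from the table
(\<open>reaches_trace\<close>).\<close>

section \<open>Shortest tours in Kalmanson matrices\<close>

text \<open>The length of a walk that does not return to its start. Unlike the index sum that defines
the length of a tour, it is amenable to induction over lists.\<close>

fun walk :: "('a \<Rightarrow> 'a \<Rightarrow> real) \<Rightarrow> 'a list \<Rightarrow> real" where
  "walk D (x # y # zs) = D x y + walk D (y # zs)"
| "walk D _ = 0"

lemma walk_append: "walk D (xs @ y # ys) = walk D (xs @ [y]) + walk D (y # ys)"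
proof (induction xs)
  case (Cons x xs)
  then show ?case by (cases xs) auto
qed simp

lemma walk_snoc: "xs \<noteq> [] \<Longrightarrow> walk D (xs @ [y]) = walk D xs + D (last xs) y"
proof (induction xs)
  case (Cons x xs)
  then show ?case by (cases xs) auto
qed simp

lemma walk_map: "walk D (map f xs) = walk (\<lambda>i j. D (f i) (f j)) xs"
  by (induction xs rule: induct_list012) auto

lemma walk_eq_sum: "walk D xs = (\<Sum>i<length xs - 1. D (xs ! i) (xs ! Suc i))"
proof (induction xs rule: induct_list012)
  case (3 x y zs)
  then show ?case by (simp add: sum.lessThan_Suc_shift del: sum.lessThan_Suc)
qed auto

lemma tour_length_eq_walk:
  assumes "xs \<noteq> []"
  shows "tour_length C xs = walk C (xs @ [hd xs])"
proof -
  have "Suc i mod length xs = (if Suc i = length xs then 0 else Suc i)" if "i < length xs" for i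
    using that by auto
  with assms show ?thesis
    by (auto simp: tour_length_def walk_eq_sum nth_append hd_conv_nth intro!: sum.cong)
qed

lemma tour_length_rotate: "tour_length C (xs @ ys) = tour_length C (ys @ xs)"
proof (cases "xs = [] \<or> ys = []")
  case False
  then obtain x xs' y ys' where "xs = x # xs'" "ys = y # ys'"
    by (meson neq_Nil_conv)
  then show ?thesis
    using walk_append[of C xs y "ys' @ [x]"] walk_append[of C ys x "xs' @ [y]"]
    by (simp add: tour_length_eq_walk)
qed auto

lemma tour_length_snoc:
  assumes "xs \<noteq> []"
  shows "tour_length C (xs @ [m]) =
    tour_length C xs - C (last xs) (hd xs) + C (last xs) m + C m (hd xs)"
  using assms by (simp add: tour_length_eq_walk walk_snoc del: append_assoc)

text \<open>Suppose that \<open>lo\<close> and \<open>hi\<close> are the least and the greatest node on a tour.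
Then no gap of the tour is cheaper for the insertion of a still greater node \<open>m\<close> than a gap
between \<open>hi\<close> and \<open>lo\<close>. To move the gap, replace its ends one at a time: the
second Kalmanson inequality handles the replacement of the smaller end by \<open>lo\<close>, the first one
that of the greater end by \<open>hi\<close>. The case \<open>a = b\<close> arises for tours of one node.\<close>

lemma insertion_cost:
  assumes K: "kalmanson n C"
    and bounds: "1 \<le> lo" "lo \<le> a" "a \<le> hi" "lo \<le> b" "b \<le> hi" "hi < m" "m \<le> n"
    and distinct: "a \<noteq> b \<or> lo = hi"
  shows "C hi m + C m lo - C hi lo \<le> C b m + C m a - C b a"
proof -
  have sym: "C i j = C j i" if "i \<in> {1..n}" "j \<in> {1..n}" for i j
    using K that unfolding kalmanson_def by blast
  have kal: "C i j + C l r \<le> C i l + C j r" "C i r + C j l \<le> C i l + C j r"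
    if "1 \<le> i" "i < j" "j < l" "l < r" "r \<le> n" for i j l r
    using K that unfolding kalmanson_def by blast+
  have less: "C x y + C hi m + C lo m \<le> C x m + C y m + C lo hi"
    if "lo \<le> x" "x < y" "y \<le> hi" for x y
  proof -
    have "C lo m + C x hi \<le> C lo hi + C x m"
      using kal(2)[of lo x hi m] that bounds by (cases "lo = x") auto
    moreover have "C x y + C hi m \<le> C x hi + C y m"
      using kal(1)[of x y hi m] that bounds by (cases "y = hi") auto
    ultimately show ?thesis by linarith
  qed
  have s: "C m lo = C lo m" "C hi lo = C lo hi" "C m a = C a m" "C b a = C a b"
    using sym bounds by auto
  consider "a < b" | "b < a" | "a = b" "lo = hi" using distinct by linarith
  then show ?thesis
  proof cases
    case 1 then show ?thesis using less[of a b] bounds s by linarith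
  next
    case 2 then show ?thesis using less[of b a] bounds s by linarith
  next
    case 3
    then have "a = lo" "b = lo" "hi = lo" using bounds by auto
    then show ?thesis by simp
  qed
qed

lemma sorted_hd_last: "sorted xs \<Longrightarrow> x \<in> set xs \<Longrightarrow> hd xs \<le> x \<and> x \<le> last xs"
  by (induction xs) auto

text \<open>Induction on the number of nodes. Removing the greatest node from any tour leaves a tour that
is no shorter than the sorted one; by \<open>insertion_cost\<close> putting the node back costs at
least as much as putting it at the end of the sorted tour, between the greatest and the least of the other
nodes.\<close>

lemma kalmanson_sorted_tour_optimal:
  assumes K: "kalmanson n C"
  shows "sorted \<sigma> \<Longrightarrow> distinct \<sigma> \<Longrightarrow> distinct \<tau> \<Longrightarrow> set \<sigma> = set \<tau> \<Longrightarrow> set \<sigma> \<subseteq> {1..n} \<Longrightarrow>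
    tour_length C \<sigma> \<le> tour_length C \<tau>"
proof (induction \<sigma> arbitrary: \<tau> rule: rev_induct)
  case (snoc m xs)
  then obtain ys zs where \<tau>: "\<tau> = ys @ m # zs"
    by (metis in_set_conv_decomp split_list)
  define \<rho> where "\<rho> = zs @ ys"
  have \<rho>: "distinct \<rho>" "set \<rho> = set xs"
    using snoc.prems \<tau> unfolding \<rho>_def by auto
  have \<tau>\<rho>: "tour_length C \<tau> = tour_length C (\<rho> @ [m])"
    using tour_length_rotate[of C "ys @ [m]" zs] unfolding \<tau> \<rho>_def by simp
  show ?case
  proof (cases "xs = []")
    case True
    then show ?thesis using \<tau>\<rho> \<rho> by simp
  next
    case False
    then have "\<rho> \<noteq> []" using \<rho> by auto
    have ends: "hd \<rho> \<in> set xs" "last \<rho> \<in> set xs" "hd xs \<in> set xs" "last xs \<in> set xs"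
      using \<open>\<rho> \<noteq> []\<close> False \<rho> by (metis hd_in_set last_in_set)+
    have srt: "sorted xs" and lt: "\<And>x. x \<in> set xs \<Longrightarrow> x < m"
      using snoc.prems by (auto simp: sorted_append order.strict_iff_order)
    have "hd \<rho> \<noteq> last \<rho> \<or> hd xs = last xs"
    proof (cases "hd \<rho> = last \<rho>")
      case True
      then have "\<rho> = [hd \<rho>]"
        using \<rho>(1) \<open>\<rho> \<noteq> []\<close> by (cases \<rho>) (auto split: if_splits)
      then have "set xs = {hd \<rho>}" using \<rho>(2) by (metis list.set(1,2))
      then show ?thesis using ends by auto
    qed simp
    then have "C (last xs) m + C m (hd xs) - C (last xs) (hd xs) \<le>
        C (last \<rho>) m + C m (hd \<rho>) - C (last \<rho>) (hd \<rho>)"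
      using ends snoc.prems sorted_hd_last[OF srt] lt
      by (intro insertion_cost[OF K]) auto
    moreover have "tour_length C xs \<le> tour_length C \<rho>"
      using snoc \<rho> by (auto simp: sorted_append)
    ultimately show ?thesis
      using tour_length_snoc[OF False, of C m] tour_length_snoc[OF \<open>\<rho> \<noteq> []\<close>, of C m] \<tau>\<rho>
      by linarith
  qed
qed simp

section \<open>Dealing out the nodes\<close>

text \<open>The least cost of completing two unfinished tours that currently end in \<open>a\<close> and
  \<open>b\<close>, where the first one has \<open>c\<close> nodes so far, when the nodes in the list are still
  to be dealt out in this order. Both tours return to \<open>0\<close>. The balancing condition appears
  as \<open>c + c = q\<close> at the end: the two tours together always have \<open>q\<close> nodes, so
  it suffices to look at the first.\<close>

fun completion ::
    "(nat \<Rightarrow> nat \<Rightarrow> real) \<Rightarrow> (nat \<Rightarrow> bool) \<Rightarrow> nat \<Rightarrow> nat list \<Rightarrow> nat \<Rightarrow> nat \<Rightarrow> nat \<Rightarrow> ereal" where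
  "completion D F q [] a b c = (if c + c = q then ereal (D a 0 + D b 0) else \<infinity>)"
| "completion D F q (k # ks) a b c =
     (if F k then ereal (D a k + D b k) + completion D F q ks k k (Suc c)
      else min (ereal (D a k) + completion D F q ks k b (Suc c))
               (ereal (D b k) + completion D F q ks a k c))"

text \<open>A distribution of the nodes is one of the alternatives over which \<open>completion\<close> takes
the minimum at every node. The predicates \<open>U\<close> and \<open>V\<close> describe the distribution for
the whole list, so that they stay the same in the induction.\<close>

lemma completion_lower_bound:
  assumes "\<And>k. k \<in> set ks \<Longrightarrow> if F k then U k \<and> V k else U k \<noteq> V k"
    and "2 * (c + length (filter U ks)) = q"
  shows "completion D F q ks a b c \<le>
    ereal (walk D (a # filter U ks @ [0]) + walk D (b # filter V ks @ [0]))"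
  using assms
proof (induction ks arbitrary: a b c)
  case (Cons k ks)
  have IH: "completion D F q ks a' b' c' \<le>
      ereal (walk D (a' # filter U ks @ [0]) + walk D (b' # filter V ks @ [0]))"
    if "2 * (c' + length (filter U ks)) = q" for a' b' c'
    using that Cons.prems(1) by (intro Cons.IH) auto
  have add: "ereal x + y \<le> ereal (x + z)" if "y \<le> ereal z" for x y z
    using add_left_mono[OF that, of "ereal x"] by simp
  have k: "if F k then U k \<and> V k else U k \<noteq> V k" using Cons.prems(1) by simp
  consider "F k" "U k" "V k" | "\<not> F k" "U k" "\<not> V k" | "\<not> F k" "\<not> U k" "V k"
    using k by (auto split: if_splits)
  then show ?case
  proof cases
    case 1
    then show ?thesis
      using add[OF IH[of "Suc c" k k], of "D a k + D b k"] Cons.prems(2) by (simp add: add_ac)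
  next
    case 2
    then show ?thesis
      using add[OF IH[of "Suc c" k b], of "D a k"] Cons.prems(2)
      by (simp add: add_ac min.coboundedI1)
  next
    case 3
    then show ?thesis
      using add[OF IH[of c a k], of "D b k"] Cons.prems(2)
      by (simp add: add_ac min.coboundedI2)
  qed
qed simp

text \<open>From here on a fixed node \<open>s\<^sub>0\<close> is singled out as the common start of the tours.
Distances and fixed nodes are addressed by their position in the cyclic order that starts at
\<open>s\<^sub>0\<close>; this makes the order in which nodes are dealt out the order of the natural
numbers, with position \<open>0\<close> as the start.\<close>

locale two_period =
  fixes n :: nat and C :: "nat \<Rightarrow> nat \<Rightarrow> real" and S :: "nat set" and s\<^sub>0 :: nat
  assumes start_fixed: "s\<^sub>0 \<in> S" and fixed_nodes: "S \<subseteq> {1..n}"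
begin

definition ring :: "nat list" where
  "ring = [s\<^sub>0..<Suc n] @ [1..<s\<^sub>0]"

abbreviation D :: "nat \<Rightarrow> nat \<Rightarrow> real" where
  "D i j \<equiv> C (ring ! i) (ring ! j)"

abbreviation fixed :: "nat \<Rightarrow> bool" where
  "fixed i \<equiv> ring ! i \<in> S"

text \<open>The two tours together have \<open>n + card S\<close> nodes. The value is a least completion cost
for end positions \<open>a\<close>, \<open>b\<close> with \<open>max a b + 1 = k\<close>.\<close>

abbreviation togo :: "nat \<Rightarrow> nat \<Rightarrow> nat \<Rightarrow> nat \<Rightarrow> ereal" where
  "togo k \<equiv> completion D fixed (n + card S) [k..<n]"

lemma start_bounds: "1 \<le> s\<^sub>0" "s\<^sub>0 \<le> n"
  using start_fixed fixed_nodes by auto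

lemma finite_S: "finite S"
  using fixed_nodes finite_subset by blast

lemma length_ring: "length ring = n"
  using start_bounds by (simp add: ring_def)

lemma set_ring: "set ring = {1..n}"
  using start_bounds by (auto simp: ring_def)

lemma distinct_ring: "distinct ring"
  by (auto simp: ring_def)

lemma nth_ring: "i < n \<Longrightarrow> ring ! i = (if s\<^sub>0 + i \<le> n then s\<^sub>0 + i else s\<^sub>0 + i - n)"
  using start_bounds by (auto simp: ring_def nth_append simp del: upt_Suc)

lemma nth_ring_0: "ring ! 0 = s\<^sub>0"
  using start_bounds by (simp add: nth_ring)

lemma nth_ring_bounds: "i < n \<Longrightarrow> ring ! i \<in> {1..n}"
  using nth_mem[of i ring] by (simp add: set_ring length_ring)

lemma inj_ring: "i < n \<Longrightarrow> j < n \<Longrightarrow> ring ! i = ring ! j \<longleftrightarrow> i = j"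
  by (simp add: distinct_ring length_ring nth_eq_iff_index_eq)

lemma node_image: "(!) ring ` {..<n} = {1..n}"
proof -
  have "(!) ring ` {..<n} = set ring"
    by (auto simp: set_conv_nth length_ring)
  then show ?thesis by (simp add: set_ring)
qed

text \<open>The restriction of the cyclic order to the nodes of a tour is a cyclic shift of their
increasing order.\<close>

lemma ring_order_optimal:
  assumes K: "kalmanson n C" and \<rho>: "distinct \<rho>" "set \<rho> \<subseteq> {1..n}" "s\<^sub>0 \<in> set \<rho>"
  shows "walk D (0 # filter (\<lambda>i. ring ! i \<in> set \<rho>) [1..<n] @ [0]) \<le> tour_length C \<rho>"
proof -
  let ?in = "\<lambda>v. v \<in> set \<rho>"
  let ?is = "filter (\<lambda>i. ring ! i \<in> set \<rho>) [1..<n]"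
  have "filter ?in ring = map ((!) ring) (filter (\<lambda>i. ring ! i \<in> set \<rho>) [0..<n])"
    by (subst map_nth[of ring, symmetric]) (simp add: filter_map comp_def length_ring)
  also have "[0..<n] = 0 # [1..<n]"
    using start_bounds by (simp add: upt_conv_Cons)
  finally have "filter ?in ring = map ((!) ring) (0 # ?is)"
    using \<rho> nth_ring_0 by simp
  then have "walk D (0 # ?is @ [0]) = tour_length C (filter ?in ring)"
    using walk_map[of C "(!) ring" "0 # ?is @ [0]"] by (simp add: tour_length_eq_walk)
  also have "\<dots> = tour_length C (filter ?in ([1..<s\<^sub>0] @ [s\<^sub>0..<Suc n]))"
    unfolding ring_def filter_append by (rule tour_length_rotate)
  also have "[1..<s\<^sub>0] @ [s\<^sub>0..<Suc n] = [1..<Suc n]"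
    using upt_add_eq_append[of 1 "s\<^sub>0" "Suc n - s\<^sub>0"] start_bounds by (simp del: upt_Suc)
  also have "tour_length C (filter ?in [1..<Suc n]) \<le> tour_length C \<rho>"
    using \<rho> by (intro kalmanson_sorted_tour_optimal[OF K]) (auto simp del: upt_Suc intro: sorted_wrt_filter)
  finally show ?thesis .
qed

lemma togo_lower_bound:
  assumes K: "kalmanson n C" and feas: "feasible_2tsp n S (\<sigma>, \<tau>)"
  shows "togo 1 0 0 1 \<le> ereal (total_length C (\<sigma>, \<tau>))"
proof -
  let ?U = "\<lambda>i. ring ! i \<in> set \<sigma>" and ?V = "\<lambda>i. ring ! i \<in> set \<tau>"
  have \<sigma>: "distinct \<sigma>" "set \<sigma> \<subseteq> {1..n}" "S \<subseteq> set \<sigma>" "2 * card (set \<sigma>) = n + card S"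
    and \<tau>: "distinct \<tau>" "set \<tau> \<subseteq> {1..n}" "S \<subseteq> set \<tau>"
    and split: "\<And>v. v \<in> {1..n} - S \<Longrightarrow> (v \<in> set \<sigma>) \<noteq> (v \<in> set \<tau>)"
    using feas by (auto simp: feasible_2tsp_def tour_on_def)
  \<comment> \<open>Position \<open>0\<close> is not among the nodes to be dealt out but belongs to the first tour,
    whence the initial count \<open>1\<close>.\<close>
  have image: "set \<sigma> = (!) ring ` {i. i < n \<and> ?U i}"
    using \<sigma>(2) node_image by auto
  have "card (set \<sigma>) = card {i. i < n \<and> ?U i}"
    by (subst image, rule card_image) (auto simp: inj_ring intro!: inj_onI)
  also have "\<dots> = length (filter ?U [0..<n])"
    by (simp add: length_filter_conv_card cong: conj_cong)
  also have "[0..<n] = 0 # [1..<n]"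
    using start_bounds by (simp add: upt_conv_Cons)
  finally have "2 * (1 + length (filter ?U [1..<n])) = n + card S"
    using \<sigma> start_fixed nth_ring_0 by (simp add: subset_iff)
  then have "togo 1 0 0 1 \<le>
      ereal (walk D (0 # filter ?U [1..<n] @ [0]) + walk D (0 # filter ?V [1..<n] @ [0]))"
    using \<sigma>(3) \<tau>(3) split nth_ring_bounds
    by (intro completion_lower_bound) auto
  also have "\<dots> \<le> ereal (total_length C (\<sigma>, \<tau>))"
    using ring_order_optimal[OF K, of \<sigma>] ring_order_optimal[OF K, of \<tau>] \<sigma> \<tau> start_fixed
    by (auto simp: total_length_def intro!: add_mono)
  finally show ?thesis .
qed

text \<open>Parity enters here: half of the non-fixed nodes go to each tour.\<close>

lemma feasible_exists:
  assumes "even (n + card S)"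
  obtains \<sigma> \<tau> where "feasible_2tsp n S (\<sigma>, \<tau>)"
proof -
  have cS: "card S \<le> n" using card_mono[OF _ fixed_nodes] by simp
  have c: "card ({1..n} - S) = n - card S"
    using fixed_nodes finite_S by (simp add: card_Diff_subset)
  obtain U where U: "U \<subseteq> {1..n} - S" "card U = (n - card S) div 2"
    using obtain_subset_with_card_n[of "(n - card S) div 2" "{1..n} - S"] c by auto
  have fU: "finite U" using U(1) finite_subset by blast
  have "even (n - card S)" using assms cS by simp
  then have "2 * card U = n - card S" using U(2) by simp
  moreover have "card (S \<union> U) = card S + card U"
    using U finite_S fU by (intro card_Un_disjoint) auto
  moreover have "card ({1..n} - U) = n - card U"
    using U fU by (subst card_Diff_subset) auto
  ultimately have cards: "2 * card (S \<union> U) = n + card S" "2 * card ({1..n} - U) = n + card S"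
    using cS by linarith+
  have "feasible_2tsp n S (sorted_list_of_set (S \<union> U), sorted_list_of_set ({1..n} - U))"
    unfolding feasible_2tsp_def tour_on_def
  proof (intro case_prodI exI conjI ballI)
    show "S \<union> U \<subseteq> {1..n}" "{1..n} - U \<subseteq> {1..n}" using U(1) fixed_nodes by auto
  qed (use cards U(1) fixed_nodes finite_S fU in auto)
  then show ?thesis by (rule that)
qed

lemma card_fixed_positions: "card {i. i < n \<and> fixed i} = card S"
proof -
  have "S = (!) ring ` {i. i < n \<and> fixed i}"
    using fixed_nodes node_image by auto
  moreover have "inj_on ((!) ring) {i. i < n \<and> fixed i}"
    by (auto simp: inj_ring intro!: inj_onI)
  ultimately show ?thesis by (metis card_image)
qed

text \<open>Balance is required for the first tour only: counting the union and the intersection of the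
two node sets gives \<open>n + card S\<close> nodes on both tours together.\<close>

lemma optimal_if_togo_attained:
  assumes K: "kalmanson n C"
    and us: "us \<noteq> []" "hd us = 0" "distinct us" and vs: "vs \<noteq> []" "hd vs = 0" "distinct vs"
    and split: "set us \<union> set vs = {..<n}" "set us \<inter> set vs = {i. i < n \<and> fixed i}"
    and len: "2 * length us = n + card S"
    and attained: "ereal (walk D (us @ [0]) + walk D (vs @ [0])) = togo 1 0 0 1"
  shows "optimal_2tsp n C S (map ((!) ring) us, map ((!) ring) vs)"
proof -
  let ?node = "(!) ring"
  have inj: "inj_on ?node {..<n}"
    using inj_ring by (auto intro: inj_onI)
  have sub: "set us \<subseteq> {..<n}" "set vs \<subseteq> {..<n}" using split(1) by auto
  have dist: "distinct (map ?node us)" "distinct (map ?node vs)"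
    using us vs inj_on_subset[OF inj] sub by (auto simp: distinct_map)
  have both: "v \<in> ?node ` set us \<and> v \<in> ?node ` set vs" if "v \<in> S" for v
  proof -
    have "v \<in> ?node ` {..<n}" using that fixed_nodes node_image by auto
    then obtain i where "i < n" "v = ring ! i" by auto
    then have "i \<in> set us \<inter> set vs" using split(2) that by auto
    then show ?thesis using \<open>v = ring ! i\<close> by auto
  qed
  have one: "(v \<in> ?node ` set us) \<noteq> (v \<in> ?node ` set vs)" if "v \<in> {1..n} - S" for v
  proof -
    have "v \<in> ?node ` {..<n}" using that node_image by simp
    then obtain i where i: "i < n" "v = ring ! i" by auto
    have "v \<in> ?node ` X \<longleftrightarrow> i \<in> X" if "X \<subseteq> {..<n}" for X
      using inj_on_image_mem_iff[OF inj _ that] i by simp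
    moreover have "i \<in> set us \<union> set vs" "i \<notin> set us \<inter> set vs" using split i that by auto
    ultimately show ?thesis using sub by blast
  qed
  have "length us + length vs = card (set us \<union> set vs) + card (set us \<inter> set vs)"
    using distinct_card[OF us(3)] distinct_card[OF vs(3)] card_Un_Int[of "set us" "set vs"] by simp
  then have len_sum: "length us + length vs = n + card S"
    using split card_fixed_positions by simp
  have "feasible_2tsp n S (map ?node us, map ?node vs)"
    unfolding feasible_2tsp_def tour_on_def
  proof (intro case_prodI exI conjI ballI)
    show "set (map ?node us) \<subseteq> {1..n}" "set (map ?node vs) \<subseteq> {1..n}"
      using sub node_image by auto
    show "2 * card (set (map ?node us)) = n + card S" "2 * card (set (map ?node vs)) = n + card S"
      using dist[THEN distinct_card] len len_sum by simp_all
    show "v \<in> set (map ?node us)" "v \<in> set (map ?node vs)" if "v \<in> S" for v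
      using both[OF that] by simp_all
    show "(v \<in> set (map ?node us)) \<noteq> (v \<in> set (map ?node vs))" if "v \<in> {1..n} - S" for v
      using one[OF that] by simp
    show "distinct (map ?node us)" "distinct (map ?node vs)" by (fact dist)+
  qed (rule refl)+
  moreover have "ereal (total_length C (map ?node us, map ?node vs)) = togo 1 0 0 1"
    using us vs walk_map[of C ?node "us @ [0]"] walk_map[of C ?node "vs @ [0]"] attained
    by (simp add: total_length_def tour_length_eq_walk list.map_sel(1))
  moreover have "togo 1 0 0 1 \<le> ereal (total_length C z)" if "feasible_2tsp n S z" for z
    using togo_lower_bound[OF K, of "fst z" "snd z"] that by simp
  ultimately show ?thesis
    unfolding optimal_2tsp_def is_arg_min_def by (metis ereal_less_eq(3) not_le)
qed

end

section \<open>Total correctness with step counts\<close>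

definition reaches :: "com \<Rightarrow> state \<Rightarrow> nat \<Rightarrow> (state \<Rightarrow> bool) \<Rightarrow> bool" where
  "reaches c s T Q \<longleftrightarrow> (\<exists>t s'. exec c s t s' \<and> t \<le> T \<and> Q s')"

lemma reaches_weaken:
  "reaches c s T Q \<Longrightarrow> T \<le> T' \<Longrightarrow> (\<And>s'. Q s' \<Longrightarrow> Q' s') \<Longrightarrow> reaches c s T' Q'"
  unfolding reaches_def by (meson order_trans)

lemma reaches_Seq:
  "reaches c s T Q \<Longrightarrow> (\<And>s'. Q s' \<Longrightarrow> reaches d s' U R) \<Longrightarrow> reaches (Seq c d) s (T + U) R"
  unfolding reaches_def by (meson add_mono exec.Seq)

text \<open>The assertion \<open>I\<close> is indexed by the number of completed iterations, so a bound on this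
number is part of the invariant and termination needs no separate argument.\<close>

lemma reaches_While:
  assumes "I 0 s"
    and step: "\<And>i s. I i s \<Longrightarrow> i < N \<Longrightarrow> bval b s \<and> reaches c s T (I (Suc i))"
    and exit: "\<And>s. I N s \<Longrightarrow> \<not> bval b s \<and> Q s"
  shows "reaches (While b c) s (Suc N * (1 + bcost b + T)) Q"
proof -
  have "reaches (While b c) s (Suc (N - i) * (1 + bcost b + T)) Q" if "I i s" "i \<le> N" for i s
    using that(2,1)
  proof (induction i arbitrary: s rule: inc_induct)
    case base
    with exit[OF base] exec.WhileFalse[of b s c] show ?case
      unfolding reaches_def by (intro exI[of _ "1 + bcost b"] exI[of _ s]) auto
  next
    case (step i)
    from assms(2)[OF step.prems] step.hyps obtain t s'
      where 1: "bval b s" "exec c s t s'" "t \<le> T" "I (Suc i) s'"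
      unfolding reaches_def by blast
    from step.IH[OF 1(4)] obtain u s''
      where 2: "exec (While b c) s' u s''" "u \<le> Suc (N - Suc i) * (1 + bcost b + T)" "Q s''"
      unfolding reaches_def by blast
    have "Suc (N - i) = Suc (Suc (N - Suc i))" using step.hyps by simp
    with 1 2 exec.WhileTrue[OF 1(1,2) 2(1)] show ?case
      unfolding reaches_def by (intro exI[of _ "1 + bcost b + t + u"] exI[of _ s'']) auto
  qed
  from this[of 0 s] assms(1) show ?thesis by simp
qed

text \<open>A loop-free program has an explicit final state and a bound on its running time that does not
depend on the state. For conditionals the bound adds up both branches, which only costs a constant
factor. For loops, \<open>final\<close> and \<open>steps\<close> have default values.\<close>

fun straight :: "com \<Rightarrow> bool" where
  "straight (Seq c d) \<longleftrightarrow> straight c \<and> straight d"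
| "straight (Cond b c d) \<longleftrightarrow> straight c \<and> straight d"
| "straight (While b c) \<longleftrightarrow> False"
| "straight _ \<longleftrightarrow> True"

fun final :: "com \<Rightarrow> state \<Rightarrow> state" where
  "final (NAssign a ix e) s = nwrite a (map (\<lambda>i. nval i s) ix) (nval e s) s"
| "final (RAssign a ix e) s = rwrite a (map (\<lambda>i. nval i s) ix) (rval e s) s"
| "final (Seq c d) s = final d (final c s)"
| "final (Cond b c d) s = (if bval b s then final c s else final d s)"
| "final _ s = s"

fun steps :: "com \<Rightarrow> nat" where
  "steps (NAssign a ix e) = 1 + sum_list (map ncost ix) + ncost e"
| "steps (RAssign a ix e) = 1 + sum_list (map ncost ix) + rcost e"
| "steps (Seq c d) = steps c + steps d"
| "steps (Cond b c d) = 1 + bcost b + steps c + steps d"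
| "steps _ = 1"

lemma reaches_straight:
  "straight c \<Longrightarrow> Q (final c s) \<Longrightarrow> reaches c s (steps c) Q"
proof (induction c arbitrary: s Q)
  case (Seq c d)
  then show ?case
    using reaches_Seq[of c s "steps c" "\<lambda>s'. s' = final c s" d "steps d" Q] by simp
next
  case (Cond b c d)
  show ?case
  proof (cases "bval b s")
    case True
    then have "reaches c s (steps c) Q" using Cond.IH(1)[of Q s] Cond.prems by simp
    with True show ?thesis unfolding reaches_def by (force intro: exec.CondTrue)
  next
    case False
    then have "reaches d s (steps d) Q" using Cond.IH(2)[of Q s] Cond.prems by simp
    with False show ?thesis unfolding reaches_def by (force intro: exec.CondFalse)
  qed
next
  case Skip
  then show ?case
    unfolding reaches_def by (auto intro!: exI[of _ 1] exI[of _ s] exec.Skip[simplified])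
next
  case (NAssign a ix e)
  then show ?case
    using exec.NAssign[of a ix e s] unfolding reaches_def by auto
next
  case (RAssign a ix e)
  then show ?case
    using exec.RAssign[of a ix e s] unfolding reaches_def by auto
qed simp

lemma reaches_straight_then:
  "straight c \<Longrightarrow> reaches d (final c s) T Q \<Longrightarrow> reaches (Seq c d) s (steps c + T) Q"
  by (rule reaches_Seq[where Q = "\<lambda>s'. s' = final c s"]) (auto intro: reaches_straight)

lemma mem_write [simp]:
  "nmem (nwrite a ks x s) b js = (if b = a \<and> js = ks then x else nmem s b js)"
  "rmem (nwrite a ks x s) = rmem s"
  "nmem (rwrite a ks y s) = nmem s"
  "rmem (rwrite a ks y s) b js = (if b = a \<and> js = ks then y else rmem s b js)"
  by (auto simp: nwrite_def rwrite_def)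

section \<open>The program\<close>

text \<open>Roles of the variables:
  \<^item> \<open>P\<close> lists the nodes in cyclic order from position \<open>0\<close>, and \<open>q\<close> is the total
    number of nodes on both tours.
  \<^item> \<open>G\<close> holds the table of least completion costs, indexed by the positions \<open>A\<close> and
    \<open>B\<close> of the ends of the tours and the number \<open>c\<close> of nodes on the first tour.
    A nonzero entry of \<open>F\<close> marks the value \<open>\<infinity>\<close>, which no real cell can hold; the
    entry of \<open>G\<close> is then meaningless.
  \<^item> \<open>k\<close> is the number of nodes dealt out so far and also the position of the next one.
  \<^item> \<open>y\<close> counts the nodes on the second tour while the output is written.\<close>

abbreviation var :: "string \<Rightarrow> nexp" where
  "var x \<equiv> NGet x []"

abbreviation set_var :: "string \<Rightarrow> nexp \<Rightarrow> com" where
  "set_var x e \<equiv> NAssign x [] e"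

abbreviation succ :: "nexp \<Rightarrow> nexp" where
  "succ e \<equiv> NAdd e (NConst 1)"

abbreviation node :: "nexp \<Rightarrow> nexp" where
  "node e \<equiv> NGet ''P'' [e]"

abbreviation dist_nodes :: "nexp \<Rightarrow> nexp \<Rightarrow> rexp" where
  "dist_nodes e f \<equiv> RGet ''C'' [node e, node f]"

notation Seq (infixr ";;" 60)

definition find_start :: com where
  "find_start =
     set_var ''v'' (NConst 1) ;;
     While (NLess (NGet ''S'' [var ''v'']) (NConst 1)) (set_var ''v'' (succ (var ''v'')))"

definition list_nodes_body :: com where
  "list_nodes_body =
     NAssign ''P'' [var ''i''] (var ''v'') ;;
     Cond (NLess (NConst 0) (NGet ''S'' [var ''v''])) (set_var ''q'' (succ (var ''q''))) Skip ;;
     set_var ''v'' (succ (var ''v'')) ;;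
     Cond (NLess (var ''n'') (var ''v'')) (set_var ''v'' (NConst 1)) Skip ;;
     set_var ''i'' (succ (var ''i''))"

definition list_nodes :: com where
  "list_nodes =
     (set_var ''i'' (NConst 0) ;; set_var ''q'' (var ''n'')) ;;
     While (NLess (var ''i'') (var ''n'')) list_nodes_body"

definition first_value :: rexp where
  "first_value = RAdd (dist_nodes (var ''A'') (var ''k''))
     (RGet ''G'' [var ''k'', var ''B'', succ (var ''c'')])"

definition second_value :: rexp where
  "second_value = RAdd (dist_nodes (var ''B'') (var ''k''))
     (RGet ''G'' [var ''A'', var ''k'', var ''c''])"

text \<open>Decides which of the two successor states is better, treating marked entries as infinite.
In a tie, in particular between two infinite values, the second tour gets the node.\<close>

definition prefer_first :: bexp where
  "prefer_first =
     BAnd (NLess (NGet ''F'' [var ''k'', var ''B'', succ (var ''c'')]) (NConst 1))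
       (BNot (BAnd (NLess (NGet ''F'' [var ''A'', var ''k'', var ''c'']) (NConst 1))
         (BNot (RLess first_value second_value))))"

text \<open>Filling the table and reading off the solution make the same case distinction, once to
evaluate the better alternative and once to carry it out.\<close>

definition extend :: "com \<Rightarrow> com \<Rightarrow> com \<Rightarrow> com" where
  "extend both first second =
     Cond (NLess (NConst 0) (NGet ''S'' [node (var ''k'')])) both (Cond prefer_first first second)"

definition set_entry :: "nexp \<Rightarrow> rexp \<Rightarrow> com" where
  "set_entry e f =
     NAssign ''F'' [var ''A'', var ''B'', var ''c''] e ;;
     RAssign ''G'' [var ''A'', var ''B'', var ''c''] f"

text \<open>Computes the entry for the current \<open>A\<close>, \<open>B\<close> and \<open>c\<close>, provided that
\<open>k\<close> is one more than the greater of \<open>A\<close> and \<open>B\<close> and that the entries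
with greater maximum are known. For \<open>k = n\<close> both tours return to the start and
\<open>c + c\<close> is compared with \<open>q\<close>; in the absence of division, doubling \<open>c\<close>
replaces halving \<open>q\<close>, and equality is expressed by two strict inequalities.\<close>

definition evaluate :: com where
  "evaluate =
     Cond (NLess (var ''k'') (var ''n''))
       (extend
         (set_entry (NGet ''F'' [var ''k'', var ''k'', succ (var ''c'')])
           (RAdd (RAdd (dist_nodes (var ''A'') (var ''k'')) (dist_nodes (var ''B'') (var ''k'')))
             (RGet ''G'' [var ''k'', var ''k'', succ (var ''c'')])))
         (set_entry (NGet ''F'' [var ''k'', var ''B'', succ (var ''c'')]) first_value)
         (set_entry (NGet ''F'' [var ''A'', var ''k'', var ''c'']) second_value))
       (Cond (BAnd (BNot (NLess (NAdd (var ''c'') (var ''c'')) (var ''q'')))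
                   (BNot (NLess (var ''q'') (NAdd (var ''c'') (var ''c'')))))
         (set_entry (NConst 0)
           (RAdd (dist_nodes (var ''A'') (NConst 0)) (dist_nodes (var ''B'') (NConst 0))))
         (set_entry (NConst 1) (RConst 0)))"

text \<open>When \<open>k\<close> nodes have been dealt out, one tour ends in position \<open>k - 1\<close> and the
other one in some \<open>j < k\<close>; either tour can be the one that is ahead.\<close>

definition fill_c_body :: com where
  "fill_c_body =
     (set_var ''A'' (NSub (var ''k'') (NConst 1)) ;; set_var ''B'' (var ''j'')) ;; evaluate ;;
     (set_var ''A'' (var ''j'') ;; set_var ''B'' (NSub (var ''k'') (NConst 1))) ;; evaluate ;;
     set_var ''c'' (succ (var ''c''))"

definition fill_c :: com where
  "fill_c =
     set_var ''c'' (NConst 0) ;;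
     While (NLess (var ''c'') (succ (var ''k''))) fill_c_body"

definition fill_j :: com where
  "fill_j =
     set_var ''j'' (NConst 0) ;;
     While (NLess (var ''j'') (var ''k'')) (fill_c ;; set_var ''j'' (succ (var ''j'')))"

definition fill :: com where
  "fill =
     set_var ''k'' (var ''n'') ;;
     While (NLess (NConst 0) (var ''k''))
       (fill_j ;; set_var ''k'' (NSub (var ''k'') (NConst 1)))"

definition visit_first :: com where
  "visit_first =
     set_var ''c'' (succ (var ''c'')) ;;
     NAssign ''T1'' [var ''c''] (node (var ''k'')) ;;
     set_var ''A'' (var ''k'')"

definition visit_second :: com where
  "visit_second =
     set_var ''y'' (succ (var ''y'')) ;;
     NAssign ''T2'' [var ''y''] (node (var ''k'')) ;;
     set_var ''B'' (var ''k'')"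

definition trace_init :: com where
  "trace_init =
     set_var ''A'' (NConst 0) ;; set_var ''B'' (NConst 0) ;;
     set_var ''c'' (NConst 1) ;; set_var ''y'' (NConst 1) ;; set_var ''k'' (NConst 1) ;;
     NAssign ''T1'' [NConst 1] (node (NConst 0)) ;; NAssign ''T2'' [NConst 1] (node (NConst 0))"

definition trace_body :: com where
  "trace_body =
     extend (visit_first ;; visit_second) visit_first visit_second ;;
     set_var ''k'' (succ (var ''k''))"

definition trace :: com where
  "trace =
     trace_init ;;
     While (NLess (var ''k'') (var ''n'')) trace_body ;;
     (NAssign ''T1'' [NConst 0] (var ''c'') ;; NAssign ''T2'' [NConst 0] (var ''y''))"

definition balanced_2tsp :: com where
  "balanced_2tsp = find_start ;; list_nodes ;; fill ;; trace"

section \<open>The cyclic order and the value of a state in memory\<close>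

definition holds_input :: "nat \<Rightarrow> (nat \<Rightarrow> nat \<Rightarrow> real) \<Rightarrow> nat set \<Rightarrow> state \<Rightarrow> bool" where
  "holds_input n C S s \<longleftrightarrow> nmem s ''n'' [] = n \<and>
     (\<forall>i. nmem s ''S'' [i] = (if i \<in> S then 1 else 0)) \<and>
     (\<forall>i\<in>{1..n}. \<forall>j\<in>{1..n}. rmem s ''C'' [i, j] = C i j)"

lemma holds_input_write [simp]:
  "a \<noteq> ''n'' \<Longrightarrow> a \<noteq> ''S'' \<Longrightarrow> holds_input n C S (nwrite a ks x s) = holds_input n C S s"
  "b \<noteq> ''C'' \<Longrightarrow> holds_input n C S (rwrite b ks y s) = holds_input n C S s"
  by (auto simp: holds_input_def)

lemma holds_inputD:
  assumes "holds_input n C S s"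
  shows "nmem s ''n'' [] = n" "nmem s ''S'' [i] = (if i \<in> S then 1 else 0)"
    "i \<in> {1..n} \<Longrightarrow> j \<in> {1..n} \<Longrightarrow> rmem s ''C'' [i, j] = C i j"
  using assms by (auto simp: holds_input_def)

lemma holds_input_2tsp: "S \<subseteq> {1..n} \<Longrightarrow> holds_input n C S (input_2tsp n C S)"
  by (auto simp: holds_input_def input_2tsp_def)

lemma reaches_find_start:
  assumes input: "holds_input n C S s" and S: "S \<noteq> {}" "S \<subseteq> {1..n}"
  shows "reaches find_start s (Suc n * 12) (\<lambda>s'. holds_input n C S s' \<and> nmem s' ''v'' [] \<in> S)"
proof -
  have "finite S" using S finite_subset by blast
  \<comment> \<open>The search stops at the least fixed node, after \<open>s\<^sub>0 - 1\<close> iterations.\<close>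
  define s\<^sub>0 where "s\<^sub>0 = Min S"
  have s\<^sub>0: "s\<^sub>0 \<in> S" and least: "\<And>v. v < s\<^sub>0 \<Longrightarrow> v \<notin> S"
    using \<open>finite S\<close> S(1) unfolding s\<^sub>0_def by (auto simp: leD)
  have bounds: "1 \<le> s\<^sub>0" "s\<^sub>0 \<le> n" using s\<^sub>0 S(2) by auto
  define I where "I i s \<longleftrightarrow> holds_input n C S s \<and> nmem s ''v'' [] = Suc i" for i s
  have "reaches find_start s (steps (set_var ''v'' (NConst 1)) + Suc (s\<^sub>0 - 1) *
      (1 + bcost (NLess (NGet ''S'' [var ''v'']) (NConst 1)) + steps (set_var ''v'' (succ (var ''v'')))))
    (\<lambda>s'. holds_input n C S s' \<and> nmem s' ''v'' [] \<in> S)"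
    unfolding find_start_def
  proof (rule reaches_straight_then[OF _ reaches_While[where I = I]])
    show "I 0 (final (set_var ''v'' (NConst 1)) s)"
      using input by (simp add: I_def)
    show "bval (NLess (NGet ''S'' [var ''v'']) (NConst 1)) s \<and>
        reaches (set_var ''v'' (succ (var ''v''))) s (steps (set_var ''v'' (succ (var ''v'')))) (I (Suc i))"
      if "I i s" "i < s\<^sub>0 - 1" for i s
      using that least[of "Suc i"]
      by (intro conjI reaches_straight) (auto simp: I_def holds_inputD)
    show "\<not> bval (NLess (NGet ''S'' [var ''v'']) (NConst 1)) s \<and>
        holds_input n C S s \<and> nmem s ''v'' [] \<in> S" if "I (s\<^sub>0 - 1) s" for s
      using that s\<^sub>0 bounds by (auto simp: I_def holds_inputD)
  qed simp
  then show ?thesis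
    by (rule reaches_weaken) (use bounds in auto)
qed

context two_period
begin

definition nodes_listed :: "state \<Rightarrow> bool" where
  "nodes_listed s \<longleftrightarrow> holds_input n C S s \<and> (\<forall>i<n. nmem s ''P'' [i] = ring ! i) \<and>
     nmem s ''q'' [] = n + card S"

lemma nodes_listed_write [simp]:
  "a \<noteq> ''n'' \<Longrightarrow> a \<noteq> ''S'' \<Longrightarrow> a \<noteq> ''P'' \<Longrightarrow> a \<noteq> ''q'' \<Longrightarrow>
     nodes_listed (nwrite a ks x s) = nodes_listed s"
  "b \<noteq> ''C'' \<Longrightarrow> nodes_listed (rwrite b ks y s) = nodes_listed s"
  by (auto simp: nodes_listed_def)

lemma nodes_listedD:
  assumes "nodes_listed s"
  shows "nmem s ''n'' [] = n" "nmem s ''q'' [] = n + card S"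
    "i < n \<Longrightarrow> nmem s ''P'' [i] = ring ! i"
    "nmem s ''S'' [v] = (if v \<in> S then 1 else 0)"
    "i < n \<Longrightarrow> j < n \<Longrightarrow> rmem s ''C'' [ring ! i, ring ! j] = D i j"
  using assms nth_ring_bounds by (auto simp: nodes_listed_def holds_inputD)

lemma reaches_list_nodes:
  assumes input: "holds_input n C S s" and start: "nmem s ''v'' [] = s\<^sub>0"
  shows "reaches list_nodes s (Suc n * 60) nodes_listed"
proof -
  \<comment> \<open>After the last iteration, \<open>v\<close> is back at \<open>s\<^sub>0\<close>; there is no position \<open>n\<close>,
    so the formula is spelled out instead of \<open>ring ! i\<close>.\<close>
  define I where "I i s \<longleftrightarrow> holds_input n C S s \<and> nmem s ''i'' [] = i \<and>
    nmem s ''v'' [] = (if s\<^sub>0 + i \<le> n then s\<^sub>0 + i else s\<^sub>0 + i - n) \<and>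
    (\<forall>j<i. nmem s ''P'' [j] = ring ! j) \<and>
    nmem s ''q'' [] = n + card {j. j < i \<and> fixed j}" for i s
  let ?init = "set_var ''i'' (NConst 0) ;; set_var ''q'' (var ''n'')"
  have "reaches list_nodes s (steps ?init + Suc n *
      (1 + bcost (NLess (var ''i'') (var ''n'')) + steps list_nodes_body)) nodes_listed"
    unfolding list_nodes_def
  proof (rule reaches_straight_then[OF _ reaches_While[where I = I]])
    show "I 0 (final ?init s)"
      using input start start_bounds by (simp add: I_def holds_inputD)
    show "bval (NLess (var ''i'') (var ''n'')) s \<and>
        reaches list_nodes_body s (steps list_nodes_body) (I (Suc i))" if I: "I i s" "i < n" for i s
    proof (intro conjI reaches_straight)
      have v: "nmem s ''v'' [] = ring ! i" using I by (simp add: I_def nth_ring)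
      have "{j. j < Suc i \<and> fixed j} =
          (if fixed i then insert i {j. j < i \<and> fixed j} else {j. j < i \<and> fixed j})"
        by (auto simp: less_Suc_eq)
      then have "card {j. j < Suc i \<and> fixed j} =
          card {j. j < i \<and> fixed j} + (if fixed i then 1 else 0)"
        by simp
      then show "I (Suc i) (final list_nodes_body s)"
        using I v nth_ring[of i] start_bounds
        by (auto simp: I_def list_nodes_body_def holds_inputD less_Suc_eq)
    qed (use I in \<open>auto simp: I_def holds_inputD list_nodes_body_def\<close>)
    show "\<not> bval (NLess (var ''i'') (var ''n'')) s \<and> nodes_listed s" if "I n s" for s
      using that by (auto simp: I_def nodes_listed_def holds_inputD card_fixed_positions)
  qed simp
  then show ?thesis
    by (rule reaches_weaken) (auto simp: list_nodes_body_def)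
qed

text \<open>The number of nodes dealt out is recovered from the greater of the two end positions.\<close>

definition tabulated :: "state \<Rightarrow> nat \<Rightarrow> nat \<Rightarrow> nat \<Rightarrow> bool" where
  "tabulated s a b c \<longleftrightarrow> togo (Suc (max a b)) a b c =
     (if nmem s ''F'' [a, b, c] = 0 then ereal (rmem s ''G'' [a, b, c]) else \<infinity>)"

lemma tabulated_write [simp]:
  "x \<noteq> ''F'' \<Longrightarrow> tabulated (nwrite x ks u s) a b c = tabulated s a b c"
  by (auto simp: tabulated_def)

lemma togo_step:
  "k < n \<Longrightarrow> togo k a b c =
     (if fixed k then ereal (D a k + D b k) + togo (Suc k) k k (Suc c)
      else min (ereal (D a k) + togo (Suc k) k b (Suc c)) (ereal (D b k) + togo (Suc k) a k c))"
  by (simp add: upt_conv_Cons)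

text \<open>The comparison of table entries agrees with the minimum in the recursion for \<open>togo\<close>,
also if one or both values are infinite.\<close>

lemma togo_choice:
  assumes env: "nodes_listed s" and k: "nmem s ''k'' [] = k" "k < n"
    and state: "nmem s ''A'' [] = a" "nmem s ''B'' [] = b" "nmem s ''c'' [] = c" "a < k" "b < k"
    and table: "tabulated s k b (Suc c)" "tabulated s a k c"
    and free: "\<not> fixed k"
  shows "togo k a b c = (if bval prefer_first s
    then ereal (D a k) + togo (Suc k) k b (Suc c) else ereal (D b k) + togo (Suc k) a k c)"
proof -
  have "max k b = k" "max a k = k" using state by simp_all
  with assms show ?thesis
    by (auto simp: togo_step tabulated_def prefer_first_def first_value_def second_value_def
        nodes_listedD min_def split: if_splits simp del: completion.simps upt_Suc)
qed

lemma final_evaluate: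
  assumes env: "nodes_listed s" and k: "nmem s ''k'' [] = Suc (max a b)" "max a b < n"
    and state: "nmem s ''A'' [] = a" "nmem s ''B'' [] = b" "nmem s ''c'' [] = c"
    and table: "\<And>a' b' c'. \<lbrakk>max a' b' = Suc (max a b); max a' b' < n; c' \<le> Suc c\<rbrakk> \<Longrightarrow>
      tabulated s a' b' c'"
  shows "\<exists>f g. final evaluate s = rwrite ''G'' [a, b, c] g (nwrite ''F'' [a, b, c] f s) \<and>
    togo (Suc (max a b)) a b c = (if f = 0 then ereal g else \<infinity>)"
proof -
  define k where "k = Suc (max a b)"
  have lt: "a < k" "b < k" "a < n" "b < n" using k(2) by (auto simp: k_def)
  note simps = evaluate_def extend_def set_entry_def first_value_def second_value_def
    nodes_listedD k state lt
  consider "k = n" | "k < n" "fixed k" | "k < n" "\<not> fixed k" using k(2) k_def by linarith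
  then show ?thesis
  proof cases
    case 1
    have "0 < n" using lt by simp
    with 1 show ?thesis using env k state lt
      by (intro exI[of _ "if c + c = n + card S then 0 else (1 :: nat)"]
            exI[of _ "if c + c = n + card S then D a 0 + D b 0 else 0"])
        (auto simp: simps k_def[symmetric] \<open>0 < n\<close>)
  next
    case 2
    then have "tabulated s k k (Suc c)" using table by (simp add: k_def)
    with 2 show ?thesis using env k state lt
      by (auto simp: simps k_def[symmetric] togo_step tabulated_def simp del: completion.simps upt_Suc)
  next
    case 3
    then have t: "tabulated s k b (Suc c)" "tabulated s a k c"
      using table lt by (auto simp: k_def)
    have mx: "max k b = k" "max a k = k" using lt by simp_all
    from togo_choice[OF env _ 3(1) state lt(1,2) t 3(2)] 3 t mx show ?thesis
      using env k state lt
      by (auto simp: simps k_def[symmetric] tabulated_def simp del: completion.simps upt_Suc)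
  qed
qed

section \<open>Filling the table\<close>

text \<open>The progress of the three nested loops: the rows for more than \<open>k\<close> nodes dealt out are
complete, and row \<open>k\<close> is complete up to the entries for \<open>j\<close> and \<open>c\<close>, in
lexicographic order. In a row for \<open>k\<close> nodes dealt out, counts up to \<open>k\<close> suffice,
as no tour can have more nodes than that.\<close>

definition table :: "state \<Rightarrow> nat \<Rightarrow> nat \<Rightarrow> nat \<Rightarrow> bool" where
  "table s k j c \<longleftrightarrow> (\<forall>a b x. max a b < n \<longrightarrow> x \<le> Suc (max a b) \<longrightarrow>
     (k \<le> max a b \<or> Suc (max a b) = k \<and> (min a b < j \<or> min a b = j \<and> x < c)) \<longrightarrow>
     tabulated s a b x)"

lemma tableD: "table s k j c \<Longrightarrow> k \<le> max a b \<Longrightarrow> max a b < n \<Longrightarrow> x \<le> Suc (max a b) \<Longrightarrow> tabulated s a b x"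
  by (auto simp: table_def)

lemma table_write [simp]:
  "x \<noteq> ''F'' \<Longrightarrow> table (nwrite x ks u s) k j c = table s k j c"
  by (auto simp: table_def)

lemma table_start: "table s n 0 0"
  by (auto simp: table_def)

lemma table_next_row:
  assumes "table s k k 0"
  shows "table s (k - 1) 0 0"
  unfolding table_def
proof (intro allI impI)
  fix a b x
  assume ab: "max a b < n" "x \<le> Suc (max a b)"
    and "k - 1 \<le> max a b \<or> Suc (max a b) = k - 1 \<and> (min a b < 0 \<or> min a b = 0 \<and> x < 0)"
  then have "k \<le> max a b \<or> Suc (max a b) = k" by linarith
  moreover have "min a b \<le> max a b" by simp
  ultimately have "k \<le> max a b \<or> Suc (max a b) = k \<and> min a b < k" by linarith
  with ab assms show "tabulated s a b x" unfolding table_def by blast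
qed

lemma table_next_column:
  assumes "table s k j (Suc k)"
  shows "table s k (Suc j) 0"
  unfolding table_def
proof (intro allI impI)
  fix a b x
  assume ab: "max a b < n" "x \<le> Suc (max a b)"
    and "k \<le> max a b \<or> Suc (max a b) = k \<and> (min a b < Suc j \<or> min a b = Suc j \<and> x < 0)"
  then have "k \<le> max a b \<or> Suc (max a b) = k \<and> (min a b < j \<or> min a b = j \<and> x < Suc k)"
    by linarith
  with ab assms show "tabulated s a b x" unfolding table_def by blast
qed

lemma table_next_entry:
  assumes "table s k j c" "tabulated s (k - 1) j c" "tabulated s j (k - 1) c"
  shows "table s k j (Suc c)"
  unfolding table_def
proof (intro allI impI)
  fix a b x
  assume ab: "max a b < n" "x \<le> Suc (max a b)"
    and or: "k \<le> max a b \<or> Suc (max a b) = k \<and> (min a b < j \<or> min a b = j \<and> x < Suc c)"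
  show "tabulated s a b x"
  proof (cases "Suc (max a b) = k \<and> min a b = j \<and> x = c")
    case True
    then have "a = k - 1 \<and> b = j \<or> a = j \<and> b = k - 1"
      by linarith
    with True assms(2,3) show ?thesis by metis
  next
    case False
    with or have "k \<le> max a b \<or> Suc (max a b) = k \<and> (min a b < j \<or> min a b = j \<and> x < c)"
      by linarith
    with ab assms(1) show ?thesis unfolding table_def by blast
  qed
qed

lemma tabulated_store:
  assumes "togo (Suc (max a b)) a b c = (if f = 0 then ereal g else \<infinity>)"
  shows "tabulated (rwrite ''G'' [a, b, c] g (nwrite ''F'' [a, b, c] f s)) a b c"
    and "tabulated s a' b' c' \<Longrightarrow>
      tabulated (rwrite ''G'' [a, b, c] g (nwrite ''F'' [a, b, c] f s)) a' b' c'"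
  using assms unfolding tabulated_def by (auto split: if_splits simp del: completion.simps upt_Suc)

lemma table_store:
  assumes "togo (Suc (max a b)) a b c = (if f = 0 then ereal g else \<infinity>)" "table s k j x"
  shows "table (rwrite ''G'' [a, b, c] g (nwrite ''F'' [a, b, c] f s)) k j x"
  using assms(2) tabulated_store(2)[OF assms(1)] unfolding table_def by blast

text \<open>For \<open>j = k - 1\<close> both evaluations write the same entry. Otherwise the second one has
to keep the first one's entry: overwriting an entry by its correct value does no harm
(\<open>table_store\<close>, \<open>tabulated_store\<close>), so the two entries need not be told apart.\<close>

lemma final_fill_c_body:
  assumes env: "nodes_listed s" and k: "nmem s ''k'' [] = k" "k \<le> n"
    and j: "nmem s ''j'' [] = j" "j < k" and c: "nmem s ''c'' [] = c" "c \<le> k"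
    and table: "table s k j c"
  defines "s' \<equiv> final fill_c_body s"
  shows "nodes_listed s' \<and> nmem s' ''k'' [] = k \<and> nmem s' ''j'' [] = j \<and>
    nmem s' ''c'' [] = Suc c \<and> table s' k j (Suc c)"
proof -
  define s1 where "s1 = nwrite ''B'' [] j (nwrite ''A'' [] (k - 1) s)"
  have mx: "Suc (max (k - 1) j) = k" "Suc (max j (k - 1)) = k" using j by auto
  have "\<exists>f g. final evaluate s1 = rwrite ''G'' [k - 1, j, c] g (nwrite ''F'' [k - 1, j, c] f s1) \<and>
      togo (Suc (max (k - 1) j)) (k - 1) j c = (if f = 0 then ereal g else \<infinity>)"
  proof (rule final_evaluate)
    show "tabulated s1 a b x" if "max a b = Suc (max (k - 1) j)" "max a b < n" "x \<le> Suc c" for a b x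
      using tableD[OF table, of a b x] that mx c unfolding s1_def by simp
  qed (use env k j c mx in \<open>auto simp: s1_def\<close>)
  then obtain f g where 1: "final evaluate s1 = rwrite ''G'' [k - 1, j, c] g (nwrite ''F'' [k - 1, j, c] f s1)"
    "togo (Suc (max (k - 1) j)) (k - 1) j c = (if f = 0 then ereal g else \<infinity>)" by blast
  define s2 where "s2 = final evaluate s1"
  have s2: "nodes_listed s2" "nmem s2 ''k'' [] = k" "nmem s2 ''j'' [] = j" "nmem s2 ''c'' [] = c"
    "table s2 k j c" "tabulated s2 (k - 1) j c"
    using env k j c table table_store[OF 1(2), of s1 k j c] tabulated_store(1)[OF 1(2)]
    unfolding s2_def 1(1) by (auto simp: s1_def)
  define s3 where "s3 = nwrite ''B'' [] (k - 1) (nwrite ''A'' [] j s2)"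
  have "\<exists>f g. final evaluate s3 = rwrite ''G'' [j, k - 1, c] g (nwrite ''F'' [j, k - 1, c] f s3) \<and>
      togo (Suc (max j (k - 1))) j (k - 1) c = (if f = 0 then ereal g else \<infinity>)"
  proof (rule final_evaluate)
    show "tabulated s3 a b x" if "max a b = Suc (max j (k - 1))" "max a b < n" "x \<le> Suc c" for a b x
      using tableD[OF s2(5), of a b x] that mx c unfolding s3_def by simp
  qed (use s2 k mx j in \<open>auto simp: s3_def\<close>)
  then obtain f' g' where 3: "final evaluate s3 = rwrite ''G'' [j, k - 1, c] g' (nwrite ''F'' [j, k - 1, c] f' s3)"
    "togo (Suc (max j (k - 1))) j (k - 1) c = (if f' = 0 then ereal g' else \<infinity>)" by blast
  define s4 where "s4 = final evaluate s3"
  have s4: "nodes_listed s4" "nmem s4 ''k'' [] = k" "nmem s4 ''j'' [] = j" "nmem s4 ''c'' [] = c"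
    "table s4 k j c" "tabulated s4 (k - 1) j c" "tabulated s4 j (k - 1) c"
    using s2 table_store[OF 3(2), of s3 k j c] tabulated_store[OF 3(2)]
    unfolding s4_def 3(1) by (auto simp: s3_def)
  have "final (set_var ''A'' (NSub (var ''k'') (NConst 1)) ;; set_var ''B'' (var ''j'')) s = s1"
    using k j by (simp add: s1_def)
  moreover have "final (set_var ''A'' (var ''j'') ;; set_var ''B'' (NSub (var ''k'') (NConst 1))) s2 = s3"
    using s2 by (simp add: s3_def)
  ultimately have "s' = nwrite ''c'' [] (Suc c) s4"
    using s4 by (simp add: s'_def fill_c_body_def s2_def s4_def)
  then show ?thesis using s4 by (auto intro: table_next_entry)
qed

lemma steps_fill_c_body: "steps fill_c_body \<le> 500"
  by (simp add: fill_c_body_def evaluate_def extend_def set_entry_def prefer_first_def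
      first_value_def second_value_def)

text \<open>The time bounds of this and the following lemmas are rounded up generously,
so that they stay simple polynomials in \<open>n + 1\<close>.\<close>

lemma reaches_fill_c:
  assumes env: "nodes_listed s" and k: "nmem s ''k'' [] = k" "k \<le> n"
    and j: "nmem s ''j'' [] = j" "j < k" and table: "table s k j 0"
  shows "reaches fill_c s (Suc n * 2000) (\<lambda>s. nodes_listed s \<and> nmem s ''k'' [] = k \<and>
    nmem s ''j'' [] = j \<and> table s k (Suc j) 0)"
proof -
  define I where "I i s \<longleftrightarrow> nodes_listed s \<and> nmem s ''k'' [] = k \<and>
    nmem s ''j'' [] = j \<and> nmem s ''c'' [] = i \<and> table s k j i" for i s
  have "reaches fill_c s (steps (set_var ''c'' (NConst 0)) + Suc (Suc k) *
      (1 + bcost (NLess (var ''c'') (succ (var ''k''))) + steps fill_c_body))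
    (\<lambda>s. nodes_listed s \<and> nmem s ''k'' [] = k \<and> nmem s ''j'' [] = j \<and> table s k (Suc j) 0)"
    unfolding fill_c_def
  proof (rule reaches_straight_then[OF _ reaches_While[where I = I]])
    show "I 0 (final (set_var ''c'' (NConst 0)) s)"
      using assms by (simp add: I_def)
    show "bval (NLess (var ''c'') (succ (var ''k''))) s \<and>
        reaches fill_c_body s (steps fill_c_body) (I (Suc i))" if I: "I i s" "i < Suc k" for i s
    proof (intro conjI reaches_straight)
      show "I (Suc i) (final fill_c_body s)"
        using I final_fill_c_body[of s k j i] k(2) j(2) by (simp add: I_def)
      show "straight fill_c_body"
        by (simp add: fill_c_body_def evaluate_def extend_def set_entry_def)
    qed (use I in \<open>simp add: I_def\<close>)
    show "\<not> bval (NLess (var ''c'') (succ (var ''k''))) s \<and>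
        nodes_listed s \<and> nmem s ''k'' [] = k \<and> nmem s ''j'' [] = j \<and> table s k (Suc j) 0"
      if "I (Suc k) s" for s
      using that by (auto simp: I_def intro: table_next_column)
  qed simp
  moreover have "steps (set_var ''c'' (NConst 0)) + Suc (Suc k) *
      (1 + bcost (NLess (var ''c'') (succ (var ''k''))) + steps fill_c_body) \<le>
      2 + Suc (Suc n) * 506"
    using k(2) steps_fill_c_body by (intro add_mono mult_le_mono) auto
  then have "steps (set_var ''c'' (NConst 0)) + Suc (Suc k) *
      (1 + bcost (NLess (var ''c'') (succ (var ''k''))) + steps fill_c_body) \<le> Suc n * 2000"
    by simp
  ultimately show ?thesis by (blast intro: reaches_weaken)
qed

lemma reaches_fill_j:
  assumes env: "nodes_listed s" and k: "nmem s ''k'' [] = k" "k \<le> n" and table: "table s k 0 0"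
  shows "reaches fill_j s ((Suc n)\<^sup>2 * 2020) (\<lambda>s. nodes_listed s \<and> nmem s ''k'' [] = k \<and>
    table s (k - 1) 0 0)"
proof -
  define I where "I i s \<longleftrightarrow> nodes_listed s \<and> nmem s ''k'' [] = k \<and>
    nmem s ''j'' [] = i \<and> table s k i 0" for i s
  let ?next = "set_var ''j'' (succ (var ''j''))"
  have "reaches fill_j s (steps (set_var ''j'' (NConst 0)) + Suc k *
      (1 + bcost (NLess (var ''j'') (var ''k'')) + (Suc n * 2000 + steps ?next)))
    (\<lambda>s. nodes_listed s \<and> nmem s ''k'' [] = k \<and> table s (k - 1) 0 0)"
    unfolding fill_j_def
  proof (rule reaches_straight_then[OF _ reaches_While[where I = I]])
    show "I 0 (final (set_var ''j'' (NConst 0)) s)"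
      using assms by (simp add: I_def)
    show "bval (NLess (var ''j'') (var ''k'')) s \<and>
        reaches (fill_c ;; ?next) s (Suc n * 2000 + steps ?next) (I (Suc i))"
      if I: "I i s" "i < k" for i s
    proof (intro conjI reaches_Seq[OF reaches_fill_c reaches_straight])
      show "I (Suc i) (final ?next s')" if "nodes_listed s' \<and> nmem s' ''k'' [] = k \<and>
          nmem s' ''j'' [] = i \<and> table s' k (Suc i) 0" for s'
        using that by (simp add: I_def)
    qed (use I k in \<open>auto simp: I_def\<close>)
    show "\<not> bval (NLess (var ''j'') (var ''k'')) s \<and>
        nodes_listed s \<and> nmem s ''k'' [] = k \<and> table s (k - 1) 0 0" if "I k s" for s
      using that table_next_row[of s k] by (simp add: I_def)
  qed simp
  moreover have "steps (set_var ''j'' (NConst 0)) + Suc k *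
      (1 + bcost (NLess (var ''j'') (var ''k'')) + (Suc n * 2000 + steps ?next)) \<le>
      2 + Suc n * (8 + Suc n * 2000)"
    using k(2) by (intro add_mono[OF _ mult_le_mono]) auto
  then have "steps (set_var ''j'' (NConst 0)) + Suc k *
      (1 + bcost (NLess (var ''j'') (var ''k'')) + (Suc n * 2000 + steps ?next)) \<le>
      (Suc n)\<^sup>2 * 2020"
    by (rule order_trans) (simp add: power2_eq_square algebra_simps)
  ultimately show ?thesis by (blast intro: reaches_weaken)
qed

lemma reaches_fill:
  assumes env: "nodes_listed s"
  shows "reaches fill s ((Suc n) ^ 3 * 2040) (\<lambda>s. nodes_listed s \<and> table s 0 0 0)"
proof -
  define I where "I i s \<longleftrightarrow> nodes_listed s \<and> nmem s ''k'' [] = n - i \<and> table s (n - i) 0 0" for i s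
  let ?next = "set_var ''k'' (NSub (var ''k'') (NConst 1))"
  have "reaches fill s (steps (set_var ''k'' (var ''n'')) + Suc n *
      (1 + bcost (NLess (NConst 0) (var ''k'')) + ((Suc n)\<^sup>2 * 2020 + steps ?next)))
    (\<lambda>s. nodes_listed s \<and> table s 0 0 0)"
    unfolding fill_def
  proof (rule reaches_straight_then[OF _ reaches_While[where I = I]])
    show "I 0 (final (set_var ''k'' (var ''n'')) s)"
      using env by (simp add: I_def nodes_listedD table_start)
    show "bval (NLess (NConst 0) (var ''k'')) s \<and>
        reaches (fill_j ;; ?next) s ((Suc n)\<^sup>2 * 2020 + steps ?next) (I (Suc i))"
      if I: "I i s" "i < n" for i s
    proof (intro conjI reaches_Seq[OF reaches_fill_j reaches_straight])
      show "I (Suc i) (final ?next s')" if "nodes_listed s' \<and> nmem s' ''k'' [] = n - i \<and>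
          table s' (n - i - 1) 0 0" for s'
        using that by (simp add: I_def)
    qed (use I in \<open>auto simp: I_def\<close>)
    show "\<not> bval (NLess (NConst 0) (var ''k'')) s \<and> nodes_listed s \<and> table s 0 0 0"
      if "I n s" for s
      using that by (simp add: I_def)
  qed simp
  then show ?thesis
    by (rule reaches_weaken) (simp_all add: power2_eq_square power3_eq_cube algebra_simps)
qed

section \<open>Reading off an optimal solution\<close>

text \<open>Cell \<open>0\<close> is left out, since the number of nodes is written there only at the end.\<close>

definition listed :: "string \<Rightarrow> nat list \<Rightarrow> state \<Rightarrow> bool" where
  "listed x us s \<longleftrightarrow> (\<forall>i<length us. nmem s x [Suc i] = ring ! (us ! i))"

lemma listed_write [simp]:
  "y \<noteq> x \<Longrightarrow> listed x us (nwrite y ks v s) = listed x us s"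
  by (auto simp: listed_def)

lemma listed_snoc:
  "listed x us s \<Longrightarrow> m = Suc (length us) \<Longrightarrow> v = ring ! k \<Longrightarrow> listed x (us @ [k]) (nwrite x [m] v s)"
  by (auto simp: listed_def nth_append less_Suc_eq)

text \<open>The lists \<open>us\<close> and \<open>vs\<close> are the tours built from the first \<open>k\<close> positions.
The last conjunct says that no decision so far has excluded an optimal completion: the cost
already incurred plus the least cost still to come is the least total cost.\<close>

definition routed :: "nat \<Rightarrow> nat list \<Rightarrow> nat list \<Rightarrow> bool" where
  "routed k us vs \<longleftrightarrow> us \<noteq> [] \<and> vs \<noteq> [] \<and> hd us = 0 \<and> hd vs = 0 \<and> distinct us \<and> distinct vs \<and>
     set us \<union> set vs = {..<k} \<and> set us \<inter> set vs = {i. i < k \<and> fixed i} \<and>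
     ereal (walk D us + walk D vs) + togo k (last us) (last vs) (length us) = togo 1 0 0 1"

text \<open>Position \<open>0\<close> may be on both tours at once since it carries the fixed node
\<open>s\<^sub>0\<close>.\<close>

lemma routed_start: "routed 1 [0] [0]"
  using start_fixed nth_ring_0 by (auto simp: routed_def simp del: completion.simps)

lemma routed_step:
  assumes "routed k us vs" "k < n"
  defines "rest \<equiv> togo k (last us) (last vs) (length us)"
  shows "fixed k \<Longrightarrow> routed (Suc k) (us @ [k]) (vs @ [k])"
    and "\<not> fixed k \<Longrightarrow>
      rest = ereal (D (last us) k) + togo (Suc k) k (last vs) (Suc (length us)) \<Longrightarrow>
      routed (Suc k) (us @ [k]) vs"
    and "\<not> fixed k \<Longrightarrow>
      rest = ereal (D (last vs) k) + togo (Suc k) (last us) k (length us) \<Longrightarrow>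
      routed (Suc k) us (vs @ [k])"
proof -
  have sub: "k \<notin> set us" "k \<notin> set vs"
    and sets: "set us \<union> set vs = {..<k}" "set us \<inter> set vs = {i. i < k \<and> fixed i}"
    using assms(1) by (auto simp: routed_def)
  have Suc_sets: "{..<Suc k} = insert k {..<k}"
    "{i. i < Suc k \<and> fixed i} = (if fixed k then insert k {i. i < k \<and> fixed i} else {i. i < k \<and> fixed i})"
    by (auto simp: less_Suc_eq)
  have total: "ereal (walk D us + walk D vs) + rest = togo 1 0 0 1" and ends: "us \<noteq> []" "vs \<noteq> []"
    using assms by (simp_all add: routed_def)
  have shift: "ereal x + r = togo 1 0 0 1"
    if "rest = ereal d + r" "x = walk D us + walk D vs + d" for x d r
    using total that by (simp add: add.assoc flip: plus_ereal.simps(1))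
  note intros = routed_def hd_append2 Suc_sets Int_insert_right Int_insert_left
  show "routed (Suc k) (us @ [k]) (vs @ [k])" if "fixed k"
  proof -
    have "ereal (walk D (us @ [k]) + walk D (vs @ [k])) + togo (Suc k) k k (Suc (length us)) =
        togo 1 0 0 1"
      using ends that by (intro shift[of "D (last us) k + D (last vs) k"])
        (simp_all add: rest_def togo_step[OF assms(2)] walk_snoc del: completion.simps upt_Suc)
    then show ?thesis
      using assms(1) sub sets that by (simp add: intros del: completion.simps upt_Suc)
  qed
  show "routed (Suc k) (us @ [k]) vs" if "\<not> fixed k"
      "rest = ereal (D (last us) k) + togo (Suc k) k (last vs) (Suc (length us))"
  proof -
    have "ereal (walk D (us @ [k]) + walk D vs) +
        togo (Suc k) k (last vs) (Suc (length us)) = togo 1 0 0 1"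
      using ends by (intro shift[OF that(2)]) (simp add: walk_snoc)
    then show ?thesis
      using assms(1) sub sets that(1) by (simp add: intros del: completion.simps upt_Suc)
  qed
  show "routed (Suc k) us (vs @ [k])" if "\<not> fixed k"
      "rest = ereal (D (last vs) k) + togo (Suc k) (last us) k (length us)"
  proof -
    have "ereal (walk D us + walk D (vs @ [k])) +
        togo (Suc k) (last us) k (length us) = togo 1 0 0 1"
      using ends by (intro shift[OF that(2)]) (simp add: walk_snoc)
    then show ?thesis
      using assms(1) sub sets that(1) by (simp add: intros del: completion.simps upt_Suc)
  qed
qed

definition tracing :: "nat \<Rightarrow> state \<Rightarrow> bool" where
  "tracing k s \<longleftrightarrow> nodes_listed s \<and> table s 0 0 0 \<and> nmem s ''k'' [] = k \<and>
     (\<exists>us vs. routed k us vs \<and> listed ''T1'' us s \<and> listed ''T2'' vs s \<and>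
       nmem s ''A'' [] = last us \<and> nmem s ''B'' [] = last vs \<and>
       nmem s ''c'' [] = length us \<and> nmem s ''y'' [] = length vs)"

text \<open>The entries consulted for the next decision have been filled in because neither tour has more
than \<open>k\<close> nodes.\<close>

lemma tracing_step:
  assumes "tracing k s" and k: "1 \<le> k" "k < n"
  shows "tracing (Suc k) (final trace_body s)"
proof -
  from assms(1) obtain us vs where routed: "routed k us vs"
    and env: "nodes_listed s" "table s 0 0 0" "nmem s ''k'' [] = k"
    and out: "listed ''T1'' us s" "listed ''T2'' vs s"
    and state: "nmem s ''A'' [] = last us" "nmem s ''B'' [] = last vs" "nmem s ''c'' [] = length us"
    and y: "nmem s ''y'' [] = length vs"
    unfolding tracing_def by blast
  have us: "us \<noteq> []" "distinct us" "set us \<subseteq> {..<k}" and vs: "vs \<noteq> []" "set vs \<subseteq> {..<k}"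
    using routed by (auto simp: routed_def)
  have lt: "last us < k" "last vs < k"
    using last_in_set[OF us(1)] last_in_set[OF vs(1)] us(3) vs(2) by auto
  have "length us \<le> k"
    using card_mono[OF finite_lessThan us(3)] distinct_card[OF us(2)] by simp
  then have tabs: "tabulated s k (last vs) (Suc (length us))" "tabulated s (last us) k (length us)"
    using k(2) lt by (auto intro!: tableD[OF env(2)])
  note choice = togo_choice[OF env(1,3) k(2) state lt tabs]
  define s' where "s' = final trace_body s"
  note simps = s'_def trace_body_def extend_def visit_first_def visit_second_def
    nodes_listedD[OF env(1)] env state y k(2)
  have invariant: "nodes_listed s' \<and> table s' 0 0 0 \<and> nmem s' ''k'' [] = Suc k"
    by (simp add: simps)
  consider (both) "fixed k" | (first) "\<not> fixed k" "bval prefer_first s"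
    | (second) "\<not> fixed k" "\<not> bval prefer_first s" by blast
  then have "tracing (Suc k) s'"
  proof cases
    case both
    have "listed ''T1'' (us @ [k]) s'" "listed ''T2'' (vs @ [k]) s'"
      using out by (simp_all add: simps both listed_snoc)
    moreover have "nmem s' ''A'' [] = k" "nmem s' ''B'' [] = k"
      "nmem s' ''c'' [] = Suc (length us)" "nmem s' ''y'' [] = Suc (length vs)"
      by (simp_all add: simps both)
    ultimately show ?thesis
      using invariant routed_step(1)[OF routed k(2) both] unfolding tracing_def
      by (intro conjI exI[of _ "us @ [k]"] exI[of _ "vs @ [k]"]) simp_all
  next
    case first
    have "listed ''T1'' (us @ [k]) s'" "listed ''T2'' vs s'"
      using out by (simp_all add: simps first listed_snoc)
    moreover have "nmem s' ''A'' [] = k" "nmem s' ''B'' [] = last vs"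
      "nmem s' ''c'' [] = Suc (length us)" "nmem s' ''y'' [] = length vs"
      by (simp_all add: simps first)
    moreover have "routed (Suc k) (us @ [k]) vs"
      using choice[OF first(1)] first(2) by (intro routed_step(2)[OF routed k(2) first(1)]) (simp only: if_True)
    ultimately show ?thesis
      using invariant unfolding tracing_def
      by (intro conjI exI[of _ "us @ [k]"] exI[of _ vs]) simp_all
  next
    case second
    have "listed ''T1'' us s'" "listed ''T2'' (vs @ [k]) s'"
      using out by (simp_all add: simps second listed_snoc)
    moreover have "nmem s' ''A'' [] = last us" "nmem s' ''B'' [] = k"
      "nmem s' ''c'' [] = length us" "nmem s' ''y'' [] = Suc (length vs)"
      by (simp_all add: simps second)
    moreover have "routed (Suc k) us (vs @ [k])"
      using choice[OF second(1)] second(2) by (intro routed_step(3)[OF routed k(2) second(1)]) (simp only: if_False)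
    ultimately show ?thesis
      using invariant unfolding tracing_def
      by (intro conjI exI[of _ us] exI[of _ "vs @ [k]"]) simp_all
  qed
  then show ?thesis unfolding s'_def .
qed

lemma read_tour_listed:
  assumes "listed x us s" "nmem s x [0] = length us"
  shows "read_tour x s = map ((!) ring) us"
proof (rule nth_equalityI)
  show len: "length (read_tour x s) = length (map ((!) ring) us)"
    using assms(2) by (simp add: read_tour_def del: upt_Suc)
  show "read_tour x s ! i = map ((!) ring) us ! i" if "i < length (read_tour x s)" for i
    using that len assms by (simp add: read_tour_def listed_def del: upt_Suc)
qed

text \<open>If the first tour had the wrong number of nodes in the end, the remaining cost would be
\<open>\<infinity>\<close>, and so would be the least total cost. But a feasible solution exists and bounds it by
a real number.\<close>

lemma optimal_if_routed:
  assumes K: "kalmanson n C" and even: "even (n + card S)" and routed: "routed n us vs"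
  shows "optimal_2tsp n C S (map ((!) ring) us, map ((!) ring) vs)"
proof -
  obtain \<sigma> \<tau> where "feasible_2tsp n S (\<sigma>, \<tau>)" using feasible_exists[OF even] .
  then have "togo 1 0 0 1 \<le> ereal (total_length C (\<sigma>, \<tau>))"
    by (rule togo_lower_bound[OF K])
  then have finite: "togo 1 0 0 1 \<noteq> \<infinity>" by (rule neq_PInf_trans[rotated]) simp
  have total: "ereal (walk D us + walk D vs) + togo n (last us) (last vs) (length us) = togo 1 0 0 1"
    and ends: "us \<noteq> []" "vs \<noteq> []" "hd us = 0" "hd vs = 0" "distinct us" "distinct vs"
    and sets: "set us \<union> set vs = {..<n}" "set us \<inter> set vs = {i. i < n \<and> fixed i}"
    using routed unfolding routed_def by simp_all
  have len: "2 * length us = n + card S"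
  proof (rule ccontr)
    assume "2 * length us \<noteq> n + card S"
    then have "togo n (last us) (last vs) (length us) = \<infinity>" by simp
    with total finite show False by simp
  qed
  then have "togo n (last us) (last vs) (length us) = ereal (D (last us) 0 + D (last vs) 0)"
    by simp
  then have "ereal (walk D (us @ [0]) + walk D (vs @ [0])) = togo 1 0 0 1"
    using total ends(1,2) by (simp add: walk_snoc add_ac)
  with len ends sets show ?thesis
    by (intro optimal_if_togo_attained[OF K])
qed

lemma reaches_trace:
  assumes K: "kalmanson n C" and even: "even (n + card S)"
    and start: "nodes_listed s" "table s 0 0 0"
  shows "reaches trace s (Suc n * 200) (\<lambda>s. optimal_2tsp n C S (output_2tsp s))"
proof -
  let ?cond = "NLess (var ''k'') (var ''n'')"
  let ?out = "NAssign ''T1'' [NConst 0] (var ''c'') ;; NAssign ''T2'' [NConst 0] (var ''y'')"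
  have "reaches trace s (steps trace_init + (Suc (n - 1) * (1 + bcost ?cond + steps trace_body) + steps ?out))
    (\<lambda>s. optimal_2tsp n C S (output_2tsp s))"
    unfolding trace_def
  proof (rule reaches_straight_then[OF _ reaches_Seq[OF reaches_While[where I = "\<lambda>i. tracing (Suc i)"]
      reaches_straight]])
    show "straight trace_init" by (simp add: trace_init_def)
    show "tracing (Suc 0) (final trace_init s)"
      unfolding tracing_def using start start_bounds routed_start
      by (auto simp: trace_init_def nodes_listedD listed_def nth_ring_0 intro!: exI[of _ "[0]"])
    show "bval ?cond s \<and> reaches trace_body s (steps trace_body) (tracing (Suc (Suc i)))"
      if "tracing (Suc i) s" "i < n - 1" for i s
    proof (intro conjI reaches_straight)
      show "tracing (Suc (Suc i)) (final trace_body s)"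
        using that by (intro tracing_step) auto
      show "straight trace_body"
        by (simp add: trace_body_def extend_def visit_first_def visit_second_def)
      show "bval ?cond s" using that by (auto simp: tracing_def nodes_listedD)
    qed
    show "\<not> bval ?cond s \<and> tracing n s" if "tracing (Suc (n - 1)) s" for s
      using that start_bounds by (auto simp: tracing_def nodes_listedD)
    show "optimal_2tsp n C S (output_2tsp (final ?out s))" if "tracing n s" for s
    proof -
      from that obtain us vs where uv: "routed n us vs" "listed ''T1'' us s" "listed ''T2'' vs s"
        "nmem s ''c'' [] = length us" "nmem s ''y'' [] = length vs"
        unfolding tracing_def by blast
      have "listed ''T1'' us (final ?out s)" "listed ''T2'' vs (final ?out s)"
        using uv by (simp_all add: listed_def)
      then have "output_2tsp (final ?out s) = (map ((!) ring) us, map ((!) ring) vs)"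
        unfolding output_2tsp_def using uv by (simp add: read_tour_listed)
      then show ?thesis using optimal_if_routed[OF K even uv(1)] by simp
    qed
  qed simp
  moreover have "steps trace_init + (Suc (n - 1) * (1 + bcost ?cond + steps trace_body) + steps ?out) \<le> Suc n * 200"
    using start_bounds by (simp add: trace_init_def trace_body_def extend_def visit_first_def visit_second_def
        prefer_first_def first_value_def second_value_def)
  ultimately show ?thesis by (blast intro: reaches_weaken)
qed

end

lemma reaches_balanced_2tsp:
  assumes K: "kalmanson n C" and S: "S \<noteq> {}" "S \<subseteq> {1..n}" and even: "even (n + card S)"
  shows "reaches balanced_2tsp (input_2tsp n C S) (3000 * Suc n ^ 3)
    (\<lambda>s. optimal_2tsp n C S (output_2tsp s))"
proof -
  have "reaches balanced_2tsp (input_2tsp n C S)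
      (Suc n * 12 + (Suc n * 60 + (Suc n ^ 3 * 2040 + Suc n * 200)))
      (\<lambda>s. optimal_2tsp n C S (output_2tsp s))"
    unfolding balanced_2tsp_def
  proof (rule reaches_Seq[OF reaches_find_start[OF holds_input_2tsp[OF S(2)] S]])
    fix s assume s: "holds_input n C S s \<and> nmem s ''v'' [] \<in> S"
    then interpret two_period n C S "nmem s ''v'' []"
      using S by unfold_locales auto
    show "reaches (list_nodes ;; fill ;; trace) s
        (Suc n * 60 + (Suc n ^ 3 * 2040 + Suc n * 200)) (\<lambda>s. optimal_2tsp n C S (output_2tsp s))"
      using s by (intro reaches_Seq[OF reaches_list_nodes] reaches_Seq[OF reaches_fill]
          reaches_trace[OF K even]) auto
  qed
  moreover have bound: "x * 12 + (x * 60 + (y * 2040 + x * 200)) \<le> 3000 * y" if "x \<le> y" for x y :: nat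
    using that by linarith
  have "Suc n \<le> Suc n ^ 3" by (rule self_le_power) simp_all
  then have "Suc n * 12 + (Suc n * 60 + (Suc n ^ 3 * 2040 + Suc n * 200)) \<le> 3000 * Suc n ^ 3"
    using bound by blast
  ultimately show ?thesis by (blast intro: reaches_weaken)
qed

theorem proposition2p1:
  "\<exists>(P :: com) (T :: nat \<Rightarrow> nat).
     (\<forall>(n :: nat) (C :: nat \<Rightarrow> nat \<Rightarrow> real) (S :: nat set).
        kalmanson n C \<longrightarrow> S \<noteq> {} \<longrightarrow> S \<subseteq> {1..n} \<longrightarrow> even (n + card S) \<longrightarrow>
        (\<exists>t s. exec P (input_2tsp n C S) t s \<and> t \<le> T n \<and>
               optimal_2tsp n C S (output_2tsp s))) \<and>
     (\<lambda>n. real (T n)) \<in> O(\<lambda>n. real n ^ 3)"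
proof (rule exI[of _ balanced_2tsp], rule exI[of _ "\<lambda>n. 3000 * Suc n ^ 3"], intro conjI allI impI)
  show "\<exists>t s. exec balanced_2tsp (input_2tsp n C S) t s \<and> t \<le> 3000 * Suc n ^ 3 \<and>
      optimal_2tsp n C S (output_2tsp s)"
    if "kalmanson n C" "S \<noteq> {}" "S \<subseteq> {1..n}" "even (n + card S)" for n C S
    using reaches_balanced_2tsp[OF that] unfolding reaches_def .
  \<comment> \<open>The factor \<open>2 ^ 3\<close> absorbs the step from \<open>n + 1\<close> to \<open>n\<close>.\<close>
  have "real (3000 * Suc n ^ 3) \<le> 24000 * real n ^ 3" if "1 \<le> n" for n
  proof -
    have "real (Suc n) ^ 3 \<le> (2 * real n) ^ 3" using that by (intro power_mono) auto
    then show ?thesis by (simp add: power_mult_distrib)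
  qed
  then show "(\<lambda>n. real (3000 * Suc n ^ 3)) \<in> O(\<lambda>n. real n ^ 3)"
    by (intro bigoI[of _ 24000] eventually_sequentiallyI[of 1]) simp
qed

end
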